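(* Let $t_0>0$ and suppose that on $[t_0,+\infty)$ the following hold: - $0\le v(t)\in L^\infty_{\mathrm{loc}}([t_0,+\infty))$, $\frac1{v(t)}\in L^\infty_{\mathrm{loc}}([t_0,+\infty))$, $\frac1{v(t)}\in L^1(+\infty)$; - $f\in C^1([t_0,+\infty))$, $f(t_0)>0$, $f$ is non decreasing on $[t_0,+\infty)$, $v(t)\le f(t)$ a.e. on $[t_0,+\infty)$, and there are $D>0$, $\mu<1$ such that $\frac{f'(t)}{f(t)}\ge\frac1{Dt^\mu}$ for all $t\ge t_0$; - $A\in L^\infty_{\mathrm{loc}}([t_0,+\infty))$, $A(t)\ge0$ a.e. on $[t_0,+\infty)$, and $\limsup_{t\to+\infty}\int_{t_0}^t\big(\sqrt{A(s)}-\sqrt{\chi(s)}\big)ds=+\infty$; - there exists $c>0$ such that $\sqrt{A(t)}\ge\frac c2\frac{f'(t)}{f(t)}$ a.e. on $[t_0,+\infty)$; - $f$ satisfies property $(P)$ for this parameter $c$. Let $z\not\equiv0$ be a locally Lipschitz solution on $[t_0,+\infty)$ of $$\begin{cases}(v(t)z'(t))'+A(t)v(t)z(t)=0&\text{a.e. on }(t_0,+\infty)\\ z(t_0)=z_0,\end{cases}$$ with $z_0\in\mathbb{R}\backslash\{0\}$. For $\tau\in[T,+\infty)$, where $T>t_0$ is fixed, let $T_1(\tau)<T_2(\tau)$ be the first two consecutive zeros of $z(t)$ on $[\tau,+\infty)$. Then $$T_2(\tau)-\tau=O(\tau)\qquad\text{as }\tau\to+\infty.$$ Moreover, in case $f(t)=\Lambda\exp[at^\alpha\log^\beta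 t]$, with $\Lambda,a,\alpha>0$, $\beta\ge0$, we have the estimate $$\limsup_{\tau\to+\infty}\frac{T_2(\tau)}{\tau}\le\Big(\frac{c+1}{c-1}\Big)^{\frac2\alpha}.$$
   Context: A function is in $L^1(+\infty)$ if it is integrable on $[R,+\infty)$ for some large $R$. The critical function is $\chi(t)=\Big(2v(t)\int_t^{+\infty}\frac{ds}{v(s)}\Big)^{-2}$. The differential equation is understood in the integrated sense: $vz'$ agrees a.e. with a locally absolutely continuous function whose derivative equals $-Avz$ a.e. Under the stated assumptions every such solution $z$ has zeros at arbitrarily large $t$ and its zeros are isolated, so $T_1(\tau),T_2(\tau)$ are well defined. Property $(P)$. For $f\in C^0([t_0,+\infty))$, $f>0$ on $[t_0,+\infty)$, $h,k$ piecewise $C^0$ and non-negative on $[t_0,+\infty)$, and $c>0$, let $\mathcal{A}(f,h,c)$ be the set of piecewise $C^0$ functions $g:[t_0,+\infty)\to[0,+\infty)$ such that $$\limsup_{t\to+\infty}\Big(\sup_{\xi\in(0,1)}\frac{(1-\xi)g(t)f(t+g(t)+h(t))^c}{f(t+(1-\xi)g(t)+h(t))^{c+1}}\Big)<+\infty,$$ and let $\mathcal{B}(f,k,c)$ be the set of piecewise $C^0$ functions $g:[t_0,+\infty)\to[0,+\infty)$ such that $$\limsup_{t\to+\infty}\Big(\sup_{\xi\in(0,1)}\frac{\xi g(t)f(t+(1-\xi)g(t)+k(t))^c}{f(t+g(t)+k(t))\cdot f(t+k(t))^c}\Big)<+\infty.$$ We say that $f$ satisfies property $(P)$ for some $c>0$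 if, whenever $h(t),k(t)=O(t)$ as $t\to+\infty$ and $g\in\mathcal{A}(f,h,c)\cup\mathcal{B}(f,k,c)$, it follows that $g(t)=O(t)$ as $t\to+\infty$. *)

theory Defs
  imports "HOL-Analysis.Analysis" "HOL-Library.Landau_Symbols"
begin

definition Linf_loc :: "real set \<Rightarrow> (real \<Rightarrow> real) \<Rightarrow> bool" where
  "Linf_loc I g \<longleftrightarrow> set_borel_measurable lebesgue I g \<and>
     (\<forall>K. compact K \<and> K \<subseteq> I \<longrightarrow> (\<exists>M. AE x\<in>K in lebesgue. \<bar>g x\<bar> \<le> M))"

text \<open>Membership of \<open>1/v\<close> in \<open>L\<^sup>\<infinity>\<close> (locally) entails \<open>v \<noteq> 0\<close> almost everywhere. As \<open>1 / 0 = 0\<close>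
  in HOL, that part has to be stated separately.\<close>
definition recip_Linf_loc :: "real set \<Rightarrow> (real \<Rightarrow> real) \<Rightarrow> bool" where
  "recip_Linf_loc I v \<longleftrightarrow> (AE x\<in>I in lebesgue. v x \<noteq> 0) \<and> Linf_loc I (\<lambda>x. 1 / v x)"

definition L1_at_top :: "(real \<Rightarrow> real) \<Rightarrow> bool" where
  "L1_at_top g \<longleftrightarrow> (\<exists>R. set_integrable lebesgue {R..} g)"

definition crit_fun :: "(real \<Rightarrow> real) \<Rightarrow> real \<Rightarrow> real" where
  "crit_fun v t = (2 * v t * (LINT s:{t..}|lebesgue. 1 / v s)) powi (-2)"

text \<open>Absolute continuity in the \<open>\<epsilon>\<close>-\<open>\<delta>\<close> sense on every compact subinterval. A division \<open>d\<close> of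
  some subset of \<open>{a..b}\<close> is a finite family of non-overlapping compact intervals.\<close>
definition locally_abs_continuous_on :: "real set \<Rightarrow> (real \<Rightarrow> real) \<Rightarrow> bool" where
  "locally_abs_continuous_on I w \<longleftrightarrow>
     (\<forall>a b. {a..b} \<subseteq> I \<longrightarrow>
       (\<forall>\<epsilon>>0. \<exists>\<delta>>0. \<forall>d S. d division_of S \<and> S \<subseteq> {a..b} \<and> (\<Sum>k\<in>d. Sup k - Inf k) < \<delta> \<longrightarrow>
          (\<Sum>k\<in>d. \<bar>w (Sup k) - w (Inf k)\<bar>) < \<epsilon>))"

definition locally_lipschitz_on :: "real set \<Rightarrow> (real \<Rightarrow> real) \<Rightarrow> bool" where
  "locally_lipschitz_on I z \<longleftrightarrow> (\<forall>x\<in>I. \<exists>e>0. \<exists>L. L-lipschitz_on (ball x e \<inter> I) z)"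

text \<open>\<open>(v z')' + A v z = 0\<close> almost everywhere on \<open>(t0, \<infinity>)\<close>, where \<open>w\<close> is the locally absolutely
  continuous representative of \<open>v z'\<close>.\<close>
definition solves_ode :: "real \<Rightarrow> (real \<Rightarrow> real) \<Rightarrow> (real \<Rightarrow> real) \<Rightarrow> (real \<Rightarrow> real) \<Rightarrow> bool" where
  "solves_ode t0 v A z \<longleftrightarrow>
     (\<exists>w. locally_abs_continuous_on {t0..} w \<and>
          (AE t\<in>{t0<..} in lebesgue. \<exists>z'. (z has_real_derivative z') (at t) \<and> v t * z' = w t) \<and>
          (AE t\<in>{t0<..} in lebesgue. (w has_real_derivative - (A t * v t * z t)) (at t)))"

text \<open>The exceptional set \<open>S\<close> has finitely many points in every compact interval, and finite
  one-sided limits exist there.\<close>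
definition piecewise_C0 :: "real \<Rightarrow> (real \<Rightarrow> real) \<Rightarrow> bool" where
  "piecewise_C0 t0 g \<longleftrightarrow>
     (\<exists>S\<subseteq>{t0..}. (\<forall>b. finite (S \<inter> {..b})) \<and> continuous_on ({t0..} - S) g \<and>
        (\<forall>x\<in>S. (\<exists>l. (g \<longlongrightarrow> l) (at_right x)) \<and> (x > t0 \<longrightarrow> (\<exists>l. (g \<longlongrightarrow> l) (at_left x)))))"

definition pwc_nonneg :: "real \<Rightarrow> (real \<Rightarrow> real) \<Rightarrow> bool" where
  "pwc_nonneg t0 g \<longleftrightarrow> piecewise_C0 t0 g \<and> (\<forall>t\<ge>t0. 0 \<le> g t)"

definition classA :: "real \<Rightarrow> (real \<Rightarrow> real) \<Rightarrow> (real \<Rightarrow> real) \<Rightarrow> real \<Rightarrow> (real \<Rightarrow> real) set" where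
  "classA t0 f h c = {g. pwc_nonneg t0 g \<and>
     Limsup at_top (\<lambda>t. SUP \<xi>\<in>{0<..<1}.
       ereal ((1 - \<xi>) * g t * f (t + g t + h t) powr c
              / f (t + (1 - \<xi>) * g t + h t) powr (c + 1))) < \<infinity>}"

definition classB :: "real \<Rightarrow> (real \<Rightarrow> real) \<Rightarrow> (real \<Rightarrow> real) \<Rightarrow> real \<Rightarrow> (real \<Rightarrow> real) set" where
  "classB t0 f k c = {g. pwc_nonneg t0 g \<and>
     Limsup at_top (\<lambda>t. SUP \<xi>\<in>{0<..<1}.
       ereal (\<xi> * g t * f (t + (1 - \<xi>) * g t + k t) powr c
              / (f (t + g t + k t) * f (t + k t) powr c))) < \<infinity>}"

definition property_P :: "real \<Rightarrow> (real \<Rightarrow> real) \<Rightarrow> real \<Rightarrow> bool" where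
  "property_P t0 f c \<longleftrightarrow>
     continuous_on {t0..} f \<and> (\<forall>t\<ge>t0. 0 < f t) \<and> 0 < c \<and>
     (\<forall>h k g. pwc_nonneg t0 h \<and> pwc_nonneg t0 k \<and>
        h \<in> O[at_top](\<lambda>t. t) \<and> k \<in> O[at_top](\<lambda>t. t) \<and>
        g \<in> classA t0 f h c \<union> classB t0 f k c \<longrightarrow> g \<in> O[at_top](\<lambda>t. t))"

text \<open>The power \<open>x\<^sup>b\<close> as it occurs in \<open>log\<^sup>\<beta> t\<close>. For \<open>b \<in> \<nat>\<close> it is the ordinary power, also for
  \<open>x \<le> 0\<close>; in particular \<open>log\<^sup>0 t = 1\<close> at \<open>t = 1\<close>, whereas \<open>0 powr 0 = 0\<close>.\<close>
definition real_pow :: "real \<Rightarrow> real \<Rightarrow> real" where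
  "real_pow x b = (if b \<in> \<nat> then x ^ nat \<lfloor>b\<rfloor> else x powr b)"

end

theory Submission
  imports Defs "HOL-Real_Asymp.Real_Asymp"
begin

text \<open>On an interval free of zeros, \<open>y = - v z' / z\<close> solves the Riccati equation
  \<open>y' = A v + y\<^sup>2 / v\<close> and is nondecreasing. While \<open>y \<le> - 1\<close>, the bounds
  \<open>y' \<ge> c \<bar>y\<bar> f' / f\<close> and \<open>(- 1 / y)' \<ge> 1 / f\<close> put the elapsed time into the class \<open>\<A>\<close> of property (P);
  while \<open>y \<ge> 1\<close> they put the remaining time into the class \<open>\<B>\<close>. The crossing of \<open>[- 1, 1]\<close> is short, as
  \<open>y' \<ge> 2 sqrt A - 1 / v\<close> and \<open>1 / v\<close> is integrable. Hence every interval \<open>(\<tau>, e)\<close> free of zeros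
  has \<open>e = O(\<tau>)\<close>, which also yields oscillation. For \<open>f = \<Lambda> exp (a t\<^sup>\<alpha> log\<^sup>\<beta> t)\<close> the first and the last
  phase multiply time by at most \<open>((c + 1) / c)\<^sup>1\<^sup>/\<^sup>\<alpha>\<close> and \<open>(c / (c - 1))\<^sup>1\<^sup>/\<^sup>\<alpha>\<close> asymptotically,
  and the crossing by \<open>1\<close>.\<close>

section \<open>Increments of absolutely continuous functions\<close>

text \<open>Three obstacles shape the proof. The equation holds only almost everywhere, so the
  monotonicity arguments rest on one increment inequality for absolutely continuous functions; local
  boundedness of \<open>A\<close>, \<open>v\<close> and \<open>1 / v\<close> makes \<open>w\<close>,
  and with it \<open>y\<close>, locally Lipschitz, so that products, reciprocals and logarithms stay
  within reach of that inequality. Property (P) speaks of functions \<open>g\<close> and O-bounds,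
  whereas the argument produces one zero-free interval at a time; (P) is therefore first turned into
  a statement about numbers \<open>g\<close>, with a constant uniform in \<open>t\<close>. Finally,
  \<open>y\<close> may blow up at both ends of a zero-free interval, so all estimates are made
  strictly inside it. The second zero lies beyond two successive zero-free intervals, hence a bound
  \<open>e \<le> L * \<tau>\<close> gives \<open>T2 \<tau> \<le> L * (L * \<tau>)\<close>. In the
  exponential case the factors \<open>(c + 1) / c\<close> and \<open>c / (c - 1)\<close> multiply to
  \<open>(c + 1) / (c - 1)\<close>, and squaring turns the exponent \<open>1 / \<alpha>\<close> into
  \<open>2 / \<alpha>\<close>. There \<open>c > 1\<close> is not assumed; it follows from
  (P).\<close>

lemma AE_on_imp_negligible:
  assumes "AE x\<in>I in lebesgue. P x"
  shows "\<exists>N. negligible N \<and> (\<forall>x\<in>I - N. P x)"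
proof -
  obtain N where N: "N \<in> null_sets lebesgue" "{x \<in> space lebesgue. \<not> (x \<in> I \<longrightarrow> P x)} \<subseteq> N"
    using assms unfolding eventually_ae_filter by auto
  then show ?thesis by (intro exI[of _ N]) (auto simp: negligible_iff_null_sets)
qed

text \<open>A one-sided fundamental theorem of calculus. The gauge is refined twice: at points of
  differentiability it makes \<open>w\<close> nearly linear, and at points of the null set it
  confines the intervals to an open set of small measure, where absolute continuity controls
  \<open>w\<close>.\<close>

lemma integral_le_increment:
  fixes w \<phi> :: "real \<Rightarrow> real"
  assumes ac: "locally_abs_continuous_on {a..b} w" and ab: "a \<le> b"
    and der: "AE x\<in>{a<..<b} in lebesgue. \<exists>D. (w has_real_derivative D) (at x) \<and> \<phi> x \<le> D"
    and int: "\<phi> integrable_on {a..b}"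
  shows "integral {a..b} \<phi> \<le> w b - w a"
proof -
  obtain N0 where N0: "negligible N0"
    and dN0: "\<forall>x\<in>{a<..<b} - N0. \<exists>D. (w has_real_derivative D) (at x) \<and> \<phi> x \<le> D"
    using AE_on_imp_negligible[OF der] by (elim exE conjE)
  \<comment> \<open>The derivative is known only in the open interval, so the endpoints join the
    exceptional set.\<close>
  define N where "N = N0 \<union> {a, b}"
  have N: "negligible N" unfolding N_def using N0 by (simp add: negligible_insert)
  have "\<exists>D. (w has_real_derivative D) (at x) \<and> \<phi> x \<le> D" if "x \<in> {a..b} - N" for x
    using dN0 that by (auto simp: N_def)
  then obtain w' where w': "\<And>x. x \<in> {a..b} - N \<Longrightarrow> (w has_real_derivative w' x) (at x)"
    and \<phi>w': "\<And>x. x \<in> {a..b} - N \<Longrightarrow> \<phi> x \<le> w' x" by metis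
  \<comment> \<open>Zero on the exceptional set: intervals tagged there contribute nothing to the
    Riemann sum, and the integral is unchanged.\<close>
  define \<psi> where "\<psi> x = (if x \<in> N then 0 else \<phi> x)" for x
  have \<psi>: "(\<psi> has_integral integral {a..b} \<phi>) (cbox a b)"
    using has_integral_spike[OF N _ integrable_integral[OF int], of \<psi>] by (simp add: \<psi>_def)
  \<comment> \<open>The error has three sources: \<open>\<epsilon>\<close> from the Riemann sum,
    \<open>\<epsilon> * (b - a)\<close> from the linear approximation and \<open>\<epsilon>\<close>
    from the intervals tagged in \<open>N\<close>.\<close>
  have "integral {a..b} \<phi> \<le> w b - w a + \<epsilon> * (b - a + 2)" if \<epsilon>: "\<epsilon> > 0" for \<epsilon>
  proof -
    have "\<exists>\<gamma>. gauge \<gamma> \<and> (\<forall>\<D>. \<D> tagged_division_of cbox a b \<and> \<gamma> fine \<D> \<longrightarrow>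
             norm ((\<Sum>(x, k)\<in>\<D>. measure lborel k *\<^sub>R \<psi> x) - integral {a..b} \<phi>) < \<epsilon>)"
      using \<psi> \<epsilon> unfolding has_integral by simp
    then obtain \<gamma>0 where \<gamma>0: "gauge \<gamma>0"
      and R: "\<forall>\<D>. \<D> tagged_division_of cbox a b \<and> \<gamma>0 fine \<D> \<longrightarrow>
             norm ((\<Sum>(x, k)\<in>\<D>. measure lborel k *\<^sub>R \<psi> x) - integral {a..b} \<phi>) < \<epsilon>"
      by - (elim exE conjE, rule that)
    have "\<exists>\<delta>>0. \<forall>d S. d division_of S \<and> S \<subseteq> {a..b} \<and> (\<Sum>k\<in>d. Sup k - Inf k) < \<delta> \<longrightarrow>
        (\<Sum>k\<in>d. \<bar>w (Sup k) - w (Inf k)\<bar>) < \<epsilon>"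
      using ac \<epsilon> unfolding locally_abs_continuous_on_def by simp
    then obtain \<delta> where \<delta>: "\<delta> > 0"
      and small0: "\<forall>d S. d division_of S \<and> S \<subseteq> {a..b} \<and> (\<Sum>k\<in>d. Sup k - Inf k) < \<delta> \<longrightarrow>
        (\<Sum>k\<in>d. \<bar>w (Sup k) - w (Inf k)\<bar>) < \<epsilon>"
      by - (elim exE conjE, rule that)
    note small = small0[rule_format, OF conjI, OF _ conjI]
    have Nl: "N \<in> sets lebesgue" using N negligible_imp_sets by blast
    obtain U where U: "open U" "N \<subseteq> U" "U - N \<in> lmeasurable" "emeasure lebesgue (U - N) < ennreal \<delta>"
      using sets_lebesgue_outer_open[OF Nl \<delta>] by metis
    have UN: "measure lebesgue (U - N) < \<delta>"
      using U(3,4) \<delta> by (simp add: emeasure_eq_measure2 ennreal_less_iff)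
    have Nm: "N \<in> lmeasurable" "measure lebesgue N = 0"
      using N by (auto simp: negligible_iff_measure)
    have Ueq: "(U - N) \<union> N = U" using U(2) by blast
    have Um: "U \<in> lmeasurable" using fmeasurable.Un[OF U(3) Nm(1)] unfolding Ueq .
    have "measure lebesgue ((U - N) \<union> N) \<le> measure lebesgue (U - N) + measure lebesgue N"
      by (rule measure_Un_le) (use U(3) Nl in auto)
    then have "measure lebesgue U \<le> measure lebesgue (U - N) + measure lebesgue N"
      unfolding Ueq .
    then have Umeas: "measure lebesgue U < \<delta>" using UN Nm by simp
    have "\<exists>r>0. \<forall>y. \<bar>y - x\<bar> < r \<longrightarrow> \<bar>w y - w x - w' x * (y - x)\<bar> \<le> \<epsilon> * \<bar>y - x\<bar>"
      if "x \<in> {a..b} - N" for x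
    proof -
      have "(w has_derivative (\<lambda>h. w' x * h)) (at x)"
        using w'[OF that] by (rule has_field_derivative_imp_has_derivative)
      then have "\<exists>r>0. \<forall>y. norm (y - x) < r \<longrightarrow> norm (w y - w x - w' x * (y - x)) \<le> \<epsilon> * norm (y - x)"
        using \<epsilon> unfolding has_derivative_at_alt by blast
      then show ?thesis by simp
    qed
    then obtain r where r0: "\<And>x. x \<in> {a..b} - N \<Longrightarrow> r x > 0"
      and r: "\<And>x y. x \<in> {a..b} - N \<Longrightarrow> \<bar>y - x\<bar> < r x \<Longrightarrow>
           \<bar>w y - w x - w' x * (y - x)\<bar> \<le> \<epsilon> * \<bar>y - x\<bar>" by metis
    define \<gamma> where "\<gamma> x = \<gamma>0 x \<inter> (if x \<in> N then U else if x \<in> {a..b} then ball x (r x) else UNIV)" for x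
    have "gauge \<gamma>"
      using \<gamma>0 U r0 unfolding gauge_def \<gamma>_def by auto
    then obtain p where p: "p tagged_division_of {a..b}" and fp: "\<gamma> fine p"
      using fine_division_exists_real by blast
    have fp0: "\<gamma>0 fine p" using fp unfolding fine_def \<gamma>_def by blast
    have finp: "finite p" using p by blast
    have ptag: "\<exists>u v. k = {u..v} \<and> u \<le> x \<and> x \<le> v \<and> a \<le> u \<and> v \<le> b" if xk: "(x, k) \<in> p" for x k
    proof -
      obtain u v where k: "k = {u..v}" using tagged_division_ofD(4)[OF p xk] by auto
      moreover have "x \<in> k" "k \<subseteq> {a..b}" using tagged_division_ofD(2,3)[OF p xk] by auto
      ultimately show ?thesis by auto
    qed
    define pN where "pN = {(x, k). (x, k) \<in> p \<and> x \<in> N}"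
    have pNp: "pN \<subseteq> p" unfolding pN_def by auto
    have part: "pN tagged_partial_division_of {a..b}"
      using p pNp tagged_partial_division_subset unfolding tagged_division_of_def by blast
    define d where "d = snd ` pN"
    have div: "d division_of \<Union>d" unfolding d_def by (rule partial_division_of_tagged_division[OF part])
    have dint: "\<exists>x u v. k = {u..v} \<and> u \<le> v \<and> a \<le> u \<and> v \<le> b \<and> x \<in> N \<and> (x, k) \<in> p" if kd: "k \<in> d" for k
    proof -
      obtain x where "(x, k) \<in> p" "x \<in> N" using kd unfolding d_def pN_def by auto
      then show ?thesis using ptag[of x k] by force
    qed
    have dU: "\<Union>d \<subseteq> U"
    proof
      fix t assume "t \<in> \<Union>d"
      then obtain k where k: "k \<in> d" "t \<in> k" by blast
      then obtain x where x: "x \<in> N" "(x, k) \<in> p" using dint by blast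
      then have "k \<subseteq> \<gamma> x" using fp unfolding fine_def by blast
      then show "t \<in> U" using x k unfolding \<gamma>_def by auto
    qed
    have dab: "\<Union>d \<subseteq> {a..b}" using dint by fastforce
    have "(\<Sum>k\<in>d. Sup k - Inf k) = (\<Sum>k\<in>d. measure lebesgue k)"
    proof (rule sum.cong[OF refl])
      fix k assume "k \<in> d"
      from dint[OF this] show "Sup k - Inf k = measure lebesgue k" by auto
    qed
    also have "\<dots> = measure lebesgue (\<Union>d)" by (rule content_division[OF div])
    also have "\<dots> \<le> measure lebesgue U"
      using dU Um lmeasurable_division[OF div] by (intro measure_mono_fmeasurable) auto
    finally have "(\<Sum>k\<in>d. \<bar>w (Sup k) - w (Inf k)\<bar>) < \<epsilon>"
      using small[OF div dab] Umeas by linarith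
    moreover have "(\<Sum>(x,k)\<in>pN. \<bar>w (Sup k) - w (Inf k)\<bar>) = (\<Sum>k\<in>d. \<bar>w (Sup k) - w (Inf k)\<bar>)"
    proof -
      \<comment> \<open>\<open>Sup\<close> and \<open>Inf\<close> of the empty set are unspecified,
        while the passage from tagged pairs to intervals requires a function that vanishes on every
        interval with empty interior, the empty one included.\<close>
      define \<Delta> where "\<Delta> k = (if k = {} then 0 else \<bar>w (Sup k) - w (Inf k)\<bar>)" for k
      have "(\<Sum>(x,k)\<in>pN. \<bar>w (Sup k) - w (Inf k)\<bar>) = (\<Sum>(x,k)\<in>pN. \<Delta> k)"
        using pNp ptag by (intro sum.cong) (force simp: \<Delta>_def)+
      also have "\<dots> = (\<Sum>k\<in>d. \<Delta> k)" unfolding d_def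
      proof (rule sum.over_tagged_division_lemma[OF tagged_partial_division_of_Union_self[OF part]])
        fix u v :: real assume "box u v = {}"
        then have "v \<le> u" by (simp add: not_less)
        then show "\<Delta> (cbox u v) = 0"
          by (cases "u = v") (auto simp: \<Delta>_def)
      qed
      also have "\<dots> = (\<Sum>k\<in>d. \<bar>w (Sup k) - w (Inf k)\<bar>)"
        using dint by (intro sum.cong) (force simp: \<Delta>_def)+
      finally show ?thesis .
    qed
    ultimately have sN: "(\<Sum>(x,k)\<in>pN. \<bar>w (Sup k) - w (Inf k)\<bar>) < \<epsilon>" by simp
    have pw: "measure lborel k *\<^sub>R \<psi> x - \<epsilon> * measure lborel k - (if x \<in> N then \<bar>w (Sup k) - w (Inf k)\<bar> else 0)
       \<le> w (Sup k) - w (Inf k)" if xk: "(x, k) \<in> p" for x k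
    proof -
      obtain u v where k: "k = {u..v}" and uv: "u \<le> x" "x \<le> v" "a \<le> u" "v \<le> b" using ptag[OF xk] by blast
      have c: "measure lborel k = v - u" "Sup k = v" "Inf k = u" using k uv by auto
      show ?thesis
      proof (cases "x \<in> N")
        case True
        have "0 \<le> \<epsilon> * (v - u)" using uv \<epsilon> by simp
        then show ?thesis using True c by (simp add: \<psi>_def)
      next
        case False
        then have x: "x \<in> {a..b} - N" using uv by auto
        have "k \<subseteq> \<gamma> x" using fp xk unfolding fine_def by blast
        then have "k \<subseteq> ball x (r x)" using x unfolding \<gamma>_def by auto
        moreover have "u \<in> k" "v \<in> k" using k uv by auto
        ultimately have "u \<in> ball x (r x)" "v \<in> ball x (r x)" by blast+
        then have "\<bar>u - x\<bar> < r x" "\<bar>v - x\<bar> < r x" by (auto simp: dist_real_def)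
        then have "\<bar>w u - w x - w' x * (u - x)\<bar> \<le> \<epsilon> * \<bar>u - x\<bar>" "\<bar>w v - w x - w' x * (v - x)\<bar> \<le> \<epsilon> * \<bar>v - x\<bar>"
          using r[OF x] by blast+
        then have "w v - w u \<ge> w' x * (v - u) - \<epsilon> * (v - u)"
          using uv by (simp add: algebra_simps abs_le_iff)
        moreover have "\<phi> x * (v - u) \<le> w' x * (v - u)"
          using \<phi>w'[OF x] uv by (intro mult_right_mono) auto
        ultimately show ?thesis using False unfolding c \<psi>_def by (simp add: algebra_simps)
      qed
    qed
    have "(\<Sum>(x,k)\<in>p. measure lborel k *\<^sub>R \<psi> x) - \<epsilon> * (\<Sum>(x,k)\<in>p. measure lborel k)
        - (\<Sum>(x,k)\<in>p. if x \<in> N then \<bar>w (Sup k) - w (Inf k)\<bar> else 0)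
      = (\<Sum>(x,k)\<in>p. measure lborel k *\<^sub>R \<psi> x - \<epsilon> * measure lborel k - (if x \<in> N then \<bar>w (Sup k) - w (Inf k)\<bar> else 0))"
      by (simp add: sum_subtractf sum_distrib_left case_prod_unfold)
    also have "\<dots> \<le> (\<Sum>(x,k)\<in>p. w (Sup k) - w (Inf k))"
      using pw by (intro sum_mono) auto
    also have "\<dots> = w b - w a" by (rule additive_tagged_division_1[OF ab p])
    finally have A: "(\<Sum>(x,k)\<in>p. measure lborel k *\<^sub>R \<psi> x) - \<epsilon> * (\<Sum>(x,k)\<in>p. measure lborel k)
        - (\<Sum>(x,k)\<in>p. if x \<in> N then \<bar>w (Sup k) - w (Inf k)\<bar> else 0) \<le> w b - w a" .
    have B: "(\<Sum>(x,k)\<in>p. measure lborel k) = b - a"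
      using additive_content_tagged_division[of p a b] p ab by simp
    have C: "(\<Sum>(x,k)\<in>p. if x \<in> N then \<bar>w (Sup k) - w (Inf k)\<bar> else 0) = (\<Sum>(x,k)\<in>pN. \<bar>w (Sup k) - w (Inf k)\<bar>)"
      by (rule sum.mono_neutral_cong_right[OF finp pNp]) (auto simp: pN_def split: if_splits)
    have "integral {a..b} \<phi> \<le> (\<Sum>(x,k)\<in>p. measure lborel k *\<^sub>R \<psi> x) + \<epsilon>"
      using R[rule_format, of p] p fp0 by (simp add: abs_less_iff)
    then show ?thesis using A B C sN by (simp add: algebra_simps)
  qed
  note * = this
  show ?thesis
  proof (rule field_le_epsilon)
    fix e :: real assume "e > 0"
    then show "integral {a..b} \<phi> \<le> w b - w a + e"
      using *[of "e / (b - a + 2)"] ab by simp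
  qed
qed

lemma lipschitz_imp_locally_abs_continuous_on:
  fixes w :: "real \<Rightarrow> real"
  assumes "L-lipschitz_on {a..b} w"
  shows "locally_abs_continuous_on {a..b} w"
  unfolding locally_abs_continuous_on_def
proof (intro allI impI)
  fix p q \<epsilon> :: real assume pq: "{p..q} \<subseteq> {a..b}" and \<epsilon>: "\<epsilon> > 0"
  have L: "L \<ge> 0" using assms lipschitz_on_nonneg by blast
  show "\<exists>\<delta>>0. \<forall>d S. d division_of S \<and> S \<subseteq> {p..q} \<and> (\<Sum>k\<in>d. Sup k - Inf k) < \<delta> \<longrightarrow>
          (\<Sum>k\<in>d. \<bar>w (Sup k) - w (Inf k)\<bar>) < \<epsilon>"
  proof (intro exI[of _ "\<epsilon> / (L + 1)"] conjI allI impI)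
    show "0 < \<epsilon> / (L + 1)" using L \<epsilon> by simp
    fix d S assume d: "d division_of S \<and> S \<subseteq> {p..q} \<and> (\<Sum>k\<in>d. Sup k - Inf k) < \<epsilon> / (L + 1)"
    have k: "Sup k \<in> {a..b} \<and> Inf k \<in> {a..b} \<and> Inf k \<le> Sup k" if kd: "k \<in> d" for k
    proof -
      have "k \<noteq> {}" "k \<subseteq> S" using division_ofD(2,3)[OF conjunct1[OF d] kd] by auto
      moreover obtain u v where "k = {u..v}" using division_ofD(4)[OF conjunct1[OF d] kd] by auto
      ultimately show ?thesis using d pq by fastforce
    qed
    have "(\<Sum>k\<in>d. \<bar>w (Sup k) - w (Inf k)\<bar>) \<le> (\<Sum>k\<in>d. L * (Sup k - Inf k))"
    proof (rule sum_mono)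
      fix k assume "k \<in> d"
      then show "\<bar>w (Sup k) - w (Inf k)\<bar> \<le> L * (Sup k - Inf k)"
        using k[of k] lipschitz_onD[OF assms, of "Sup k" "Inf k"] by (auto simp: dist_real_def)
    qed
    also have "\<dots> = L * (\<Sum>k\<in>d. Sup k - Inf k)" by (simp add: sum_distrib_left)
    also have "\<dots> \<le> L * (\<epsilon> / (L + 1))" using d L by (intro mult_left_mono) auto
    also have "\<dots> < \<epsilon>" using L \<epsilon> by (simp add: field_simps)
    finally show "(\<Sum>k\<in>d. \<bar>w (Sup k) - w (Inf k)\<bar>) < \<epsilon>" .
  qed
qed

section \<open>Lipschitz functions on compact intervals\<close>

lemma locally_abs_continuous_on_subset:
  "locally_abs_continuous_on I w \<Longrightarrow> J \<subseteq> I \<Longrightarrow> locally_abs_continuous_on J w"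
  unfolding locally_abs_continuous_on_def by (meson subset_trans)

lemma locally_abs_continuous_on_uminus:
  "locally_abs_continuous_on I w \<Longrightarrow> locally_abs_continuous_on I (\<lambda>x. - w x)"
  unfolding locally_abs_continuous_on_def by (simp add: abs_minus_commute)

lemma abs_continuous_increment_ge:
  fixes u :: "real \<Rightarrow> real"
  assumes "locally_abs_continuous_on {a..b} u" "a \<le> b"
    and "AE x in lebesgue. x \<in> {a<..<b} \<longrightarrow> (\<exists>D. (u has_real_derivative D) (at x) \<and> m \<le> D)"
  shows "m * (b - a) \<le> u b - u a"
  using integral_le_increment[OF assms] integrable_const_ivl[of m a b] assms(2) by (simp add: mult.commute)

text \<open>Only the existence of a constant matters. With the constant hidden, the predicate is
  closed under the operations that build \<open>y\<close>, \<open>ln (f t)\<close> and the auxiliary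
  functions \<open>u\<close> and \<open>E\<close>.\<close>

definition lip :: "real \<Rightarrow> real \<Rightarrow> (real \<Rightarrow> real) \<Rightarrow> bool" where
  "lip a b u \<longleftrightarrow> (\<exists>L. L-lipschitz_on {a..b} u)"

lemma lipI:
  assumes "\<And>x y. x \<in> {a..b} \<Longrightarrow> y \<in> {a..b} \<Longrightarrow> \<bar>u x - u y\<bar> \<le> L * \<bar>x - y\<bar>"
  shows "lip a b u"
proof -
  have "\<bar>L\<bar>-lipschitz_on {a..b} u"
  proof (rule lipschitz_onI)
    fix x y assume "x \<in> {a..b}" "y \<in> {a..b}"
    then have "\<bar>u x - u y\<bar> \<le> L * \<bar>x - y\<bar>" by (rule assms)
    also have "\<dots> \<le> \<bar>L\<bar> * \<bar>x - y\<bar>" by (intro mult_right_mono) auto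
    finally show "dist (u x) (u y) \<le> \<bar>L\<bar> * dist x y" by (simp add: dist_real_def)
  qed simp
  then show ?thesis unfolding lip_def by blast
qed

lemma lipD:
  assumes "lip a b u"
  shows "\<exists>L\<ge>0. \<forall>x\<in>{a..b}. \<forall>y\<in>{a..b}. \<bar>u x - u y\<bar> \<le> L * \<bar>x - y\<bar>"
proof -
  obtain L where L: "L-lipschitz_on {a..b} u" using assms lip_def by blast
  show ?thesis
    using lipschitz_onD[OF L] lipschitz_on_nonneg[OF L] unfolding dist_real_def by blast
qed

lemma lip_continuous_on: "lip a b u \<Longrightarrow> continuous_on {a..b} u"
  unfolding lip_def using lipschitz_on_continuous_on by blast

lemma lip_abs_continuous: "lip a b u \<Longrightarrow> locally_abs_continuous_on {a..b} u"
  unfolding lip_def using lipschitz_imp_locally_abs_continuous_on by blast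

lemma lip_subset: "lip a b u \<Longrightarrow> {p..q} \<subseteq> {a..b} \<Longrightarrow> lip p q u"
  unfolding lip_def using lipschitz_on_subset by blast

lemma lip_bounded:
  assumes "lip a b u"
  shows "\<exists>B\<ge>0. \<forall>x\<in>{a..b}. \<bar>u x\<bar> \<le> B"
proof -
  have "bounded (u ` {a..b})"
    using compact_imp_bounded[OF compact_continuous_image[OF lip_continuous_on[OF assms]]] by simp
  then obtain B where "B > 0" "\<forall>x\<in>{a..b}. \<bar>u x\<bar> \<le> B"
    unfolding bounded_pos by auto
  then show ?thesis by (intro exI[of _ B]) simp
qed

lemma lip_add: "lip a b u \<Longrightarrow> lip a b g \<Longrightarrow> lip a b (\<lambda>x. u x + g x)"
  unfolding lip_def using lipschitz_on_add by blast

lemma lip_cmult: "lip a b u \<Longrightarrow> lip a b (\<lambda>x. k * u x)"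
  unfolding lip_def using lipschitz_on_cmult_real by blast

lemma lip_mult:
  assumes u: "lip a b u" and g: "lip a b g"
  shows "lip a b (\<lambda>x. u x * g x)"
proof -
  obtain L where L: "L \<ge> 0" "\<forall>x\<in>{a..b}. \<forall>y\<in>{a..b}. \<bar>u x - u y\<bar> \<le> L * \<bar>x - y\<bar>"
    using lipD[OF u] by blast
  obtain M where M: "M \<ge> 0" "\<forall>x\<in>{a..b}. \<forall>y\<in>{a..b}. \<bar>g x - g y\<bar> \<le> M * \<bar>x - y\<bar>"
    using lipD[OF g] by blast
  obtain B where B: "B \<ge> 0" "\<forall>x\<in>{a..b}. \<bar>u x\<bar> \<le> B" using lip_bounded[OF u] by blast
  obtain C where C: "C \<ge> 0" "\<forall>x\<in>{a..b}. \<bar>g x\<bar> \<le> C" using lip_bounded[OF g] by blast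
  show ?thesis
  proof (rule lipI[of _ _ _ "B * M + L * C"])
    fix x y assume xy: "x \<in> {a..b}" "y \<in> {a..b}"
    have "\<bar>u x * g x - u y * g y\<bar> = \<bar>u x * (g x - g y) + (u x - u y) * g y\<bar>"
      by (simp add: algebra_simps)
    also have "\<dots> \<le> \<bar>u x\<bar> * \<bar>g x - g y\<bar> + \<bar>u x - u y\<bar> * \<bar>g y\<bar>"
      by (metis abs_mult abs_triangle_ineq)
    also have "\<dots> \<le> B * (M * \<bar>x - y\<bar>) + (L * \<bar>x - y\<bar>) * C"
      using L M B C xy by (intro add_mono mult_mono) auto
    finally show "\<bar>u x * g x - u y * g y\<bar> \<le> (B * M + L * C) * \<bar>x - y\<bar>" by (simp add: algebra_simps)
  qed
qed

lemma lip_compose_C1: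
  fixes G :: "real \<Rightarrow> real"
  assumes u: "lip a b u" and "\<And>x. x \<in> {a..b} \<Longrightarrow> u x \<in> {p..q}"
    and G: "\<And>x. x \<in> {p..q} \<Longrightarrow> (G has_real_derivative G' x) (at x within {p..q})"
    and "continuous_on {p..q} G'"
  shows "lip a b (\<lambda>x. G (u x))"
proof -
  obtain L where L: "L-lipschitz_on {a..b} u" using u lip_def by blast
  have "bounded (G' ` {p..q})"
    using compact_imp_bounded[OF compact_continuous_image[OF assms(4)]] by simp
  then obtain B where B: "B > 0" "\<forall>x\<in>{p..q}. \<bar>G' x\<bar> \<le> B"
    unfolding bounded_pos by auto
  have "B-lipschitz_on {p..q} G"
  proof (rule bounded_derivative_imp_lipschitz)
    fix x assume x: "x \<in> {p..q}"
    show "(G has_derivative (\<lambda>h. G' x * h)) (at x within {p..q})"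
      using G[OF x] by (rule has_field_derivative_imp_has_derivative)
    show "onorm (\<lambda>h. G' x * h) \<le> B"
      using B x by (intro onorm_le) (auto simp: abs_mult mult_right_mono)
  qed (use B in auto)
  then have "B-lipschitz_on (u ` {a..b}) G"
    using assms(2) lipschitz_on_subset[of B "{p..q}" G] by blast
  from lipschitz_on_compose2[OF L this] show ?thesis unfolding lip_def by blast
qed

lemma lip_C1:
  fixes G :: "real \<Rightarrow> real"
  assumes "\<And>x. x \<in> {a..b} \<Longrightarrow> (G has_real_derivative G' x) (at x within {a..b})"
    and "continuous_on {a..b} G'"
  shows "lip a b G"
proof -
  have "lip a b (\<lambda>x. x)" by (rule lipI[of _ _ _ 1]) auto
  from lip_compose_C1[OF this _ assms] show ?thesis by auto
qed

lemma lip_inverse: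
  assumes u: "lip a b u" and nz: "\<And>x. x \<in> {a..b} \<Longrightarrow> u x \<noteq> 0"
  shows "lip a b (\<lambda>x. 1 / u x)"
proof (cases "a \<le> b")
  case True
  obtain L where L: "L \<ge> 0" "\<forall>x\<in>{a..b}. \<forall>y\<in>{a..b}. \<bar>u x - u y\<bar> \<le> L * \<bar>x - y\<bar>"
    using lipD[OF u] by blast
  have "continuous_on {a..b} (\<lambda>x. \<bar>u x\<bar>)"
    using lip_continuous_on[OF u] by (rule continuous_on_rabs)
  then obtain s where s: "s \<in> {a..b}" "\<And>x. x \<in> {a..b} \<Longrightarrow> \<bar>u s\<bar> \<le> \<bar>u x\<bar>"
    using continuous_attains_inf[of "{a..b}" "\<lambda>x. \<bar>u x\<bar>"] True by auto
  define m where "m = \<bar>u s\<bar>"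
  have m: "m > 0" using nz s(1) m_def by simp
  show ?thesis
  proof (rule lipI[of _ _ _ "L / m\<^sup>2"])
    fix x y assume xy: "x \<in> {a..b}" "y \<in> {a..b}"
    have "\<bar>1 / u x - 1 / u y\<bar> = \<bar>u x - u y\<bar> / (\<bar>u x\<bar> * \<bar>u y\<bar>)"
      using nz xy by (simp add: diff_frac_eq abs_mult abs_minus_commute)
    also have "\<dots> \<le> L * \<bar>x - y\<bar> / (m * m)"
    proof (rule frac_le)
      show "m * m \<le> \<bar>u x\<bar> * \<bar>u y\<bar>" using s(2) xy m by (intro mult_mono) (auto simp: m_def)
    qed (use m L xy in auto)
    finally show "\<bar>1 / u x - 1 / u y\<bar> \<le> L / m\<^sup>2 * \<bar>x - y\<bar>" by (simp add: power2_eq_square)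
  qed
qed (auto intro: lipI)

lemma lip_ln:
  assumes u: "lip a b u" and pos: "\<And>x. x \<in> {a..b} \<Longrightarrow> u x > 0"
  shows "lip a b (\<lambda>x. ln (u x))"
proof (cases "a \<le> b")
  case True
  obtain s where s: "s \<in> {a..b}" "\<And>x. x \<in> {a..b} \<Longrightarrow> u s \<le> u x"
    using continuous_attains_inf[of "{a..b}" u] lip_continuous_on[OF u] True by auto
  obtain B where B: "\<forall>x\<in>{a..b}. \<bar>u x\<bar> \<le> B" using lip_bounded[OF u] by blast
  have us: "u s > 0" using pos s by blast
  show ?thesis
  proof (rule lip_compose_C1[OF u])
    show "\<And>x. x \<in> {a..b} \<Longrightarrow> u x \<in> {u s..B}" using s B by (fastforce simp: abs_le_iff)
    show "continuous_on {u s..B} (\<lambda>x. 1 / x)" using us by (intro continuous_intros) auto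
    show "(ln has_real_derivative 1 / x) (at x within {u s..B})" if "x \<in> {u s..B}" for x
      using us that by (auto intro!: derivative_eq_intros)
  qed
qed (auto intro: lipI)

section \<open>Uniform form of property (P)\<close>

text \<open>A function vanishing off a locally finite set is piecewise continuous, so property (P) can be
  tested on functions that are nonzero only along a sequence. This makes its conclusion uniform.\<close>

lemma pwc_nonneg_spikes:
  assumes "X \<subseteq> {t0..}" "\<And>b. finite (X \<inter> {..b})" "\<And>t. t \<in> X \<Longrightarrow> 0 \<le> G t"
  shows "pwc_nonneg t0 (\<lambda>t. if t \<in> X then G t else 0)" (is "pwc_nonneg t0 ?g")
proof -
  have cont: "continuous_on ({t0..} - X) ?g"
    by (rule continuous_on_eq[OF continuous_on_const[of _ 0]]) auto
  have "(?g \<longlongrightarrow> 0) (at x)" for x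
  proof -
    obtain d where d: "d > 0" "\<And>s. s \<in> X \<inter> {..x + 1} \<Longrightarrow> s \<noteq> x \<Longrightarrow> d \<le> dist x s"
      using finite_set_avoid[OF assms(2)] by metis
    have "?g y = 0" if "y \<noteq> x" "dist y x < min d 1" for y
    proof -
      have "y \<le> x + 1" using that by (auto simp: dist_real_def)
      then show ?thesis using d(2)[of y] that by (auto simp: dist_commute)
    qed
    then have "eventually (\<lambda>y. ?g y = 0) (at x)"
      unfolding eventually_at using d(1) by (intro exI[of _ "min d 1"]) auto
    then show ?thesis by (simp add: tendsto_eventually)
  qed
  then have "(?g \<longlongrightarrow> 0) (at_right x)" "(?g \<longlongrightarrow> 0) (at_left x)" for x
    by (simp_all add: filterlim_at_split)
  then have "piecewise_C0 t0 ?g"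
    unfolding piecewise_C0_def using assms(1,2) cont by (intro exI[of _ X]) blast
  then show ?thesis unfolding pwc_nonneg_def using assms(3) by simp
qed

text \<open>If no uniform \<open>K\<close> and \<open>R\<close> exist, a counterexample is available
  for each \<open>K = n\<close> beyond any prescribed time. Planting these as spikes along a
  sequence gives one function with bounded quotients that exceeds \<open>n * t\<close> at the
  \<open>n\<close>-th spike, against (P). The parameter \<open>q\<close> stands for the quotient of
  either class.\<close>

lemma uniform_bound_of_spikes:
  fixes q :: "real \<Rightarrow> real \<Rightarrow> real \<Rightarrow> real \<Rightarrow> real"
  assumes P: "\<And>h g. pwc_nonneg t0 h \<Longrightarrow> pwc_nonneg t0 g \<Longrightarrow> h \<in> O[at_top](\<lambda>t. t) \<Longrightarrow>
      Limsup at_top (\<lambda>t. SUP \<xi>\<in>{0<..<1}. ereal (q \<xi> t (h t) (g t))) < \<infinity> \<Longrightarrow> g \<in> O[at_top](\<lambda>t. t)"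
    and q0: "\<And>\<xi> t h. q \<xi> t h 0 = 0"
  shows "\<exists>K R. \<forall>t\<ge>R. \<forall>h g. 0 \<le> h \<longrightarrow> h \<le> C * t \<longrightarrow> 0 \<le> g \<longrightarrow> (\<forall>\<xi>\<in>{0<..<1}. q \<xi> t h g \<le> M) \<longrightarrow> g \<le> K * t"
proof (rule ccontr)
  assume "\<not> ?thesis"
  then have "\<forall>K R. \<exists>t h g. t \<ge> R \<and> 0 \<le> h \<and> h \<le> C * t \<and> 0 \<le> g \<and> (\<forall>\<xi>\<in>{0<..<1}. q \<xi> t h g \<le> M) \<and> g > K * t"
    by (meson not_le)
  then obtain T H G where *: "\<And>K R. T K R \<ge> R" "\<And>K R. 0 \<le> H K R" "\<And>K R. H K R \<le> C * T K R"
    "\<And>K R. 0 \<le> G K R" "\<And>K R. \<forall>\<xi>\<in>{0<..<1}. q \<xi> (T K R) (H K R) (G K R) \<le> M"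
    "\<And>K R. G K R > K * T K R" by metis
  \<comment> \<open>\<open>r n\<close> is the time after which the \<open>n\<close>-th
    counterexample is sought. Restarting one unit after the previous spike keeps the set of spikes
    locally finite.\<close>
  define r where "r = rec_nat (max t0 1) (\<lambda>n s. T (real n) s + 1)"
  define x where "x n = T (real n) (r n)" for n
  have r0: "r 0 = max t0 1" and rS: "r (Suc n) = x n + 1" for n by (simp_all add: r_def x_def)
  have xr: "x n \<ge> r n" for n unfolding x_def using *(1) by simp
  have xS: "x n + 1 \<le> x (Suc n)" for n using xr[of "Suc n"] rS by simp
  have sm: "strict_mono x" unfolding strict_mono_Suc_iff
  proof
    show "x n < x (Suc n)" for n using xS[of n] by simp
  qed
  have xn: "x n \<ge> max t0 1 + real n" for n
  proof (induction n)
    case 0 show ?case using xr[of 0] r0 by simp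
  next
    case (Suc n) then show ?case using xS[of n] by simp
  qed
  have inj: "inj x" using sm strict_mono_imp_inj_on by blast
  define X where "X = range x"
  have fin: "finite (X \<inter> {..b})" for b
  proof (rule finite_subset)
    show "X \<inter> {..b} \<subseteq> x ` {..nat \<lceil>b\<rceil>}"
    proof
      fix y assume "y \<in> X \<inter> {..b}"
      then obtain n where n: "y = x n" "x n \<le> b" unfolding X_def by auto
      then have "real n \<le> b" using xn[of n] by simp
      then have "n \<le> nat \<lceil>b\<rceil>" by linarith
      then show "y \<in> x ` {..nat \<lceil>b\<rceil>}" using n by auto
    qed
  qed simp
  have "t0 \<le> x n" for n using xn[of n] by simp
  then have Xt: "X \<subseteq> {t0..}" unfolding X_def by auto
  define hh where "hh t = (if t \<in> X then H (inv x t) (r (inv x t)) else 0)" for t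
  define gg where "gg t = (if t \<in> X then G (inv x t) (r (inv x t)) else 0)" for t
  have hx: "hh (x n) = H n (r n)" "gg (x n) = G n (r n)" for n
    unfolding hh_def gg_def X_def using inj by simp_all
  have "pwc_nonneg t0 hh" "pwc_nonneg t0 gg"
    unfolding hh_def gg_def using Xt fin * by (auto intro!: pwc_nonneg_spikes)
  moreover have "hh \<in> O[at_top](\<lambda>t. t)"
  proof (rule bigoI[of _ "\<bar>C\<bar>"], rule always_eventually, rule allI)
    fix t
    show "norm (hh t) \<le> \<bar>C\<bar> * norm t"
    proof (cases "t \<in> X")
      case True
      then obtain n where n: "t = x n" unfolding X_def by auto
      have "H n (r n) \<le> C * t" using *(3) n x_def by simp
      also have "\<dots> \<le> \<bar>C\<bar> * \<bar>t\<bar>" by (metis abs_ge_self abs_mult)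
      finally show ?thesis using n hx(1) *(2)[of n "r n"] by simp
    qed (simp add: hh_def)
  qed
  \<comment> \<open>The maximum with 0 accounts for the times between spikes, where the quotient is
    0 by \<open>q0\<close>.\<close>
  moreover have "Limsup at_top (\<lambda>t. SUP \<xi>\<in>{0<..<1}. ereal (q \<xi> t (hh t) (gg t))) \<le> ereal (max M 0)"
  proof (rule Limsup_bounded, rule always_eventually, rule allI, rule SUP_least)
    fix t \<xi> :: real assume \<xi>: "\<xi> \<in> {0<..<1}"
    show "ereal (q \<xi> t (hh t) (gg t)) \<le> ereal (max M 0)"
    proof (cases "t \<in> X")
      case True
      then obtain n where n: "t = x n" unfolding X_def by auto
      have "q \<xi> t (hh t) (gg t) \<le> M" using *(5)[of n "r n"] \<xi> n hx x_def by auto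
      then show ?thesis by (simp add: le_max_iff_disj)
    qed (simp add: gg_def q0)
  qed
  then have "Limsup at_top (\<lambda>t. SUP \<xi>\<in>{0<..<1}. ereal (q \<xi> t (hh t) (gg t))) < \<infinity>"
    by (rule le_less_trans) (simp add: max_def)
  ultimately have "gg \<in> O[at_top](\<lambda>t. t)" using P by blast
  then obtain k where k: "k > 0" "eventually (\<lambda>t. norm (gg t) \<le> k * norm t) at_top"
    using landau_o.bigE by blast
  then obtain t1 where t1: "\<And>t. t \<ge> t1 \<Longrightarrow> norm (gg t) \<le> k * norm t"
    unfolding eventually_at_top_linorder by blast
  obtain n :: nat where n: "real n \<ge> max k t1" using real_arch_simple by blast
  have xp: "x n > 0" "x n \<ge> t1" using xn[of n] n by auto
  have "G n (r n) \<le> k * x n" using t1[OF xp(2)] hx(2) xp *(4)[of n "r n"] by simp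
  also have "\<dots> \<le> n * x n" using n xp by (intro mult_right_mono) auto
  finally show False using *(6)[of n "r n"] unfolding x_def by simp
qed

text \<open>\<open>property_P\<close> binds \<open>h\<close> and \<open>k\<close> together, while
  each class mentions only one of them; the other is instantiated by the zero function.\<close>

lemma pwc_nonneg_zero: "pwc_nonneg t0 (\<lambda>_. 0)"
  unfolding pwc_nonneg_def piecewise_C0_def by (auto intro: exI[of _ "{}"])

lemma property_P_uniform_A:
  assumes "property_P t0 f c"
  shows "\<exists>K R. \<forall>t\<ge>R. \<forall>g\<ge>0. (\<forall>\<xi>\<in>{0<..<1}. (1 - \<xi>) * g * f (t + g) powr c
              / f (t + (1 - \<xi>) * g) powr (c + 1) \<le> M) \<longrightarrow> g \<le> K * t"
proof -
  define q where "q \<xi> t h g = (1 - \<xi>) * g * f (t + g + h) powr c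
              / f (t + (1 - \<xi>) * g + h) powr (c + 1)" for \<xi> t h g
  \<comment> \<open>The factor 0 forces \<open>h = 0\<close>: the negative phase begins at
    \<open>t\<close> itself.\<close>
  have "\<exists>K R. \<forall>t\<ge>R. \<forall>h g. 0 \<le> h \<longrightarrow> h \<le> 0 * t \<longrightarrow> 0 \<le> g \<longrightarrow> (\<forall>\<xi>\<in>{0<..<1}. q \<xi> t h g \<le> M) \<longrightarrow> g \<le> K * t"
  proof (rule uniform_bound_of_spikes)
    fix h g assume hg: "pwc_nonneg t0 h" "pwc_nonneg t0 g" "h \<in> O[at_top](\<lambda>t. t)"
      "Limsup at_top (\<lambda>t. SUP \<xi>\<in>{0<..<1}. ereal (q \<xi> t (h t) (g t))) < \<infinity>"
    have "g \<in> classA t0 f h c" using hg(2,4) by (simp add: classA_def q_def)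
    with hg(1,3) pwc_nonneg_zero[of t0] show "g \<in> O[at_top](\<lambda>t. t)"
      using assms unfolding property_P_def by (metis UnI1)
  qed (simp add: q_def)
  then obtain K R where KR: "\<forall>t\<ge>R. \<forall>h g. 0 \<le> h \<longrightarrow> h \<le> 0 * t \<longrightarrow> 0 \<le> g \<longrightarrow>
      (\<forall>\<xi>\<in>{0<..<1}. q \<xi> t h g \<le> M) \<longrightarrow> g \<le> K * t" by (elim exE)
  show ?thesis
  proof (intro exI allI impI)
    fix t g assume "t \<ge> R" "0 \<le> g" and "\<forall>\<xi>\<in>{0<..<1}. (1 - \<xi>) * g * f (t + g) powr c
              / f (t + (1 - \<xi>) * g) powr (c + 1) \<le> M"
    then show "g \<le> K * t" using KR[rule_format, of t 0 g] by (simp add: q_def)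
  qed
qed

text \<open>Here the shift \<open>k\<close> is kept, because the positive phase starts only at a
  later multiple of the time \<open>t\<close> against which its length is measured.\<close>

lemma property_P_uniform_B:
  assumes "property_P t0 f c"
  shows "\<exists>K R. \<forall>t\<ge>R. \<forall>k g. 0 \<le> k \<longrightarrow> k \<le> C * t \<longrightarrow> 0 \<le> g \<longrightarrow> (\<forall>\<xi>\<in>{0<..<1}. \<xi> * g * f (t + (1 - \<xi>) * g + k) powr c
              / (f (t + g + k) * f (t + k) powr c) \<le> M) \<longrightarrow> g \<le> K * t"
proof (rule uniform_bound_of_spikes)
  fix k g assume kg: "pwc_nonneg t0 k" "pwc_nonneg t0 g" "k \<in> O[at_top](\<lambda>t. t)"
    "Limsup at_top (\<lambda>t. SUP \<xi>\<in>{0<..<1}. ereal (\<xi> * g t * f (t + (1 - \<xi>) * g t + k t) powr c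
              / (f (t + g t + k t) * f (t + k t) powr c))) < \<infinity>"
  have "g \<in> classB t0 f k c" using kg(2,4) by (simp add: classB_def)
  with kg(1,3) pwc_nonneg_zero[of t0] show "g \<in> O[at_top](\<lambda>t. t)"
    using assms unfolding property_P_def by (metis UnI2)
qed simp

section \<open>The Riccati equation between zeros\<close>

text \<open>\<open>w\<close> is the absolutely continuous representative of \<open>v z'\<close>.
  Since \<open>v > 0\<close> almost everywhere, the second-order equation is rendered as the
  first-order system \<open>z' = w / v\<close>, \<open>w' = - A v z\<close>.\<close>

locale dominated_equation =
  fixes t0 c :: real and v f f' A z w :: "real \<Rightarrow> real"
  assumes c_pos: "c > 0"
    and ae: "AE t in lebesgue. t \<in> {t0<..} \<longrightarrow> 0 < v t \<and> v t \<le> f t \<and> 0 \<le> A t \<and>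
       c / 2 * (f' t / f t) \<le> sqrt (A t) \<and>
       (z has_real_derivative w t / v t) (at t) \<and>
       (w has_real_derivative - (A t * v t * z t)) (at t)"
    and coeff_bdd: "\<And>b. \<exists>B. AE t in lebesgue. t \<in> {t0<..b} \<longrightarrow> 1 / v t \<le> B \<and> A t * v t \<le> B"
    and w_ac: "locally_abs_continuous_on {t0..} w"
    and z_lip: "\<And>b. lip t0 b z"
    and z_t0: "z t0 \<noteq> 0"
    and f_deriv: "\<And>t. t \<ge> t0 \<Longrightarrow> (f has_real_derivative f' t) (at t within {t0..})"
    and f'_cont: "continuous_on {t0..} f'"
    and f_t0: "f t0 > 0"
    and f_mono: "mono_on {t0..} f"
begin

section \<open>Regularity of \<open>w\<close> and behaviour at the zeros of \<open>z\<close>\<close>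

lemma f_pos: "t \<ge> t0 \<Longrightarrow> f t > 0"
  using f_t0 mono_onD[OF f_mono, of t0 t] by simp

lemma f_le: "t0 \<le> s \<Longrightarrow> s \<le> t \<Longrightarrow> f s \<le> f t"
  using mono_onD[OF f_mono, of s t] by simp

lemma f_deriv_at: "t > t0 \<Longrightarrow> (f has_real_derivative f' t) (at t)"
  using f_deriv[of t] at_within_interior[of t "{t0..}"] by (simp add: interior_real_atLeast)

lemma lip_ln_f:
  assumes "t0 \<le> p"
  shows "lip p q (\<lambda>t. ln (f t))"
proof (rule lip_ln)
  show "lip p q f"
  proof (rule lip_C1)
    show "continuous_on {p..q} f'" by (rule continuous_on_subset[OF f'_cont]) (use assms in auto)
    show "(f has_real_derivative f' x) (at x within {p..q})" if "x \<in> {p..q}" for x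
      by (rule DERIV_subset[OF f_deriv]) (use assms that in auto)
  qed
qed (use assms f_pos in auto)

text \<open>\<open>A v\<close> and \<open>z\<close> are bounded on compact intervals, so
  \<open>w'\<close> is bounded almost everywhere. Absolute continuity turns this into a Lipschitz
  bound, through the increment inequality for \<open>w\<close> and for \<open>- w\<close>.\<close>

lemma w_lip: "lip t0 b w"
proof -
  obtain B where B: "AE t in lebesgue. t \<in> {t0<..b} \<longrightarrow> 1 / v t \<le> B \<and> A t * v t \<le> B"
    using coeff_bdd by blast
  obtain Z where Z: "Z \<ge> 0" "\<forall>t\<in>{t0..b}. \<bar>z t\<bar> \<le> Z"
    using lip_bounded[OF z_lip[of b]] by blast
  define K where "K = B * Z"
  have der: "AE t in lebesgue. t \<in> {t0<..b} \<longrightarrow>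
      (w has_real_derivative - (A t * v t * z t)) (at t) \<and> \<bar>A t * v t * z t\<bar> \<le> K"
    using ae B
  proof eventually_elim
    case (elim t)
    show ?case
    proof
      assume t: "t \<in> {t0<..b}"
      then have e: "0 < v t" "0 \<le> A t" "A t * v t \<le> B"
        "(w has_real_derivative - (A t * v t * z t)) (at t)" using elim by auto
      have "\<bar>A t * v t * z t\<bar> = A t * v t * \<bar>z t\<bar>" using e by (simp add: abs_mult)
      also have "\<dots> \<le> B * Z" using e Z t by (intro mult_mono) (auto intro: order_trans[of 0 "A t * v t"])
      finally show "(w has_real_derivative - (A t * v t * z t)) (at t) \<and> \<bar>A t * v t * z t\<bar> \<le> K"
        using e K_def by simp
    qed
  qed
  have *: "\<bar>w q - w p\<bar> \<le> K * (q - p)" if pq: "p \<in> {t0..b}" "q \<in> {t0..b}" "p \<le> q" for p q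
  proof -
    have ac: "locally_abs_continuous_on {p..q} w"
      by (rule locally_abs_continuous_on_subset[OF w_ac]) (use pq in auto)
    have "- K * (q - p) \<le> w q - w p"
    proof (rule abs_continuous_increment_ge[OF ac pq(3)])
      show "AE x in lebesgue. x \<in> {p<..<q} \<longrightarrow> (\<exists>D. (w has_real_derivative D) (at x) \<and> - K \<le> D)"
        using der
      proof eventually_elim
        case (elim x)
        then show ?case using pq by (auto simp: abs_le_iff intro!: exI[of _ "- (A x * v x * z x)"])
      qed
    qed
    moreover have "- K * (q - p) \<le> - w q - - w p"
    proof (rule abs_continuous_increment_ge[OF locally_abs_continuous_on_uminus[OF ac] pq(3)])
      show "AE x in lebesgue. x \<in> {p<..<q} \<longrightarrow> (\<exists>D. ((\<lambda>x. - w x) has_real_derivative D) (at x) \<and> - K \<le> D)"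
        using der
      proof eventually_elim
        case (elim x)
        then show ?case using pq
          by (auto simp: abs_le_iff intro!: exI[of _ "A x * v x * z x"] derivative_eq_intros)
      qed
    qed
    ultimately show ?thesis by (simp add: abs_le_iff)
  qed
  show ?thesis
  proof (rule lipI[of _ _ _ K])
    fix x y assume "x \<in> {t0..b}" "y \<in> {t0..b}"
    then show "\<bar>w x - w y\<bar> \<le> K * \<bar>x - y\<bar>"
      using *[of x y] *[of y x] by (cases "x \<le> y") (auto simp: abs_minus_commute)
  qed
qed

lemma cont_z: "continuous_on {t0..b} z" and cont_w: "continuous_on {t0..b} w"
  using lip_continuous_on z_lip w_lip by blast+

text \<open>A common zero of \<open>z\<close> and \<open>w\<close> would propagate back to \<open>t0\<close>: \<open>(z\<^sup>2 + w\<^sup>2) exp (B t)\<close> is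
  nondecreasing for \<open>B\<close> large.\<close>
lemma w_nonzero_at_zero:
  assumes x: "x \<ge> t0" "z x = 0"
  shows "w x \<noteq> 0"
proof
  assume w0: "w x = 0"
  obtain B where B: "AE t in lebesgue. t \<in> {t0<..x} \<longrightarrow> 1 / v t \<le> B \<and> A t * v t \<le> B"
    using coeff_bdd by blast
  define E where "E t = (z t * z t + w t * w t) * exp (B * t)" for t
  have "lip t0 x (\<lambda>t. exp (B * t))"
    by (rule lip_C1[where G' = "\<lambda>t. B * exp (B * t)"]) (auto intro!: derivative_eq_intros continuous_intros)
  then have "lip t0 x E" unfolding E_def by (intro lip_mult lip_add z_lip w_lip)
  then have "0 * (x - t0) \<le> E x - E t0"
  proof (rule abs_continuous_increment_ge[OF lip_abs_continuous x(1)])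
    show "AE t in lebesgue. t \<in> {t0<..<x} \<longrightarrow> (\<exists>D. (E has_real_derivative D) (at t) \<and> 0 \<le> D)"
      using ae B
    proof eventually_elim
      case (elim t)
      show ?case
      proof
        assume t: "t \<in> {t0<..<x}"
        then have e: "0 < v t" "0 \<le> A t" "1 / v t \<le> B" "A t * v t \<le> B"
          "(z has_real_derivative w t / v t) (at t)"
          "(w has_real_derivative - (A t * v t * z t)) (at t)" using elim by auto
        define D where "D = (2 * z t * w t * (1 / v t - A t * v t) + B * (z t * z t + w t * w t)) * exp (B * t)"
        have "(E has_real_derivative D) (at t)"
          unfolding E_def D_def
          by (rule derivative_eq_intros e(5,6) refl)+ (simp add: algebra_simps)
        moreover have "0 \<le> D"
        proof -
          \<comment> \<open>Both terms lie between 0 and \<open>B\<close>, hence so does the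
            absolute value of their difference.\<close>
          define \<kappa> where "\<kappa> = 1 / v t - A t * v t"
          have \<kappa>: "\<bar>\<kappa>\<bar> \<le> B" using e(1-4) unfolding \<kappa>_def abs_le_iff
            by (smt (verit) divide_nonneg_pos mult_nonneg_nonneg)
          have "\<bar>2 * z t * w t\<bar> \<le> z t * z t + w t * w t"
            using sum_squares_bound[of "z t" "w t"] sum_squares_bound[of "- z t" "w t"]
            by (simp add: abs_le_iff power2_eq_square)
          then have "\<bar>2 * z t * w t\<bar> * \<bar>\<kappa>\<bar> \<le> (z t * z t + w t * w t) * B"
            using \<kappa> by (intro mult_mono) auto
          then have "\<bar>2 * z t * w t * \<kappa>\<bar> \<le> B * (z t * z t + w t * w t)"
            by (simp add: abs_mult mult.commute)
          then have "0 \<le> 2 * z t * w t * \<kappa> + B * (z t * z t + w t * w t)" by (simp add: abs_le_iff)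
          then show ?thesis unfolding D_def \<kappa>_def by simp
        qed
        ultimately show "\<exists>D. (E has_real_derivative D) (at t) \<and> 0 \<le> D" by blast
      qed
    qed
  qed
  then have "E t0 \<le> 0" using x w0 by (simp add: E_def)
  moreover have "E t0 > 0" using z_t0 unfolding E_def
    by (simp add: add_pos_nonneg flip: power2_eq_square)
  ultimately show False by simp
qed

text \<open>At a zero \<open>w\<close> is nonzero, so it keeps its sign nearby; with
  \<open>v \<le> f\<close> the slope of \<open>\<sigma> * z\<close> is then bounded below by a
  positive constant. Isolation to the right is what makes the next zero a minimum.\<close>

lemma zero_isolated_right:
  assumes x: "x \<ge> t0" "z x = 0"
  shows "\<exists>d>0. \<forall>t\<in>{x<..x + d}. z t \<noteq> 0"
proof -
  define m where "m = \<bar>w x\<bar> / 2"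
  define \<sigma> where "\<sigma> = sgn (w x)"
  have wx: "w x \<noteq> 0" using w_nonzero_at_zero[OF x] .
  then have m: "m > 0" "\<sigma> * w x = 2 * m" "\<bar>\<sigma>\<bar> = 1"
    unfolding m_def \<sigma>_def by (auto simp: sgn_if)
  have "continuous_on {t0..x + 1} w" by (rule cont_w)
  then obtain d where d: "d > 0" "\<forall>t\<in>{t0..x + 1}. dist t x < d \<longrightarrow> dist (w t) (w x) < m"
    using x m unfolding continuous_on_iff by force
  define e where "e = min (d / 2) 1"
  have e: "e > 0" "e \<le> 1" "e < d" using d by (auto simp: e_def)
  have wm: "\<sigma> * w t \<ge> m" if "t \<in> {x..x + e}" for t
  proof -
    have "\<bar>w t - w x\<bar> < m" using d(2) that e x by (auto simp: dist_real_def)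
    then have "\<bar>\<sigma> * w t - \<sigma> * w x\<bar> < m" using m(3) by (simp add: abs_mult flip: right_diff_distrib)
    then show ?thesis using m(2) by (simp add: abs_less_iff)
  qed
  define k where "k = m / f (x + e)"
  have fx: "f (x + e) > 0" using f_pos x e by simp
  have k: "k > 0" using m fx by (simp add: k_def)
  have "z t \<noteq> 0" if t: "t \<in> {x<..x + e}" for t
  proof -
    have "lip x t (\<lambda>t. \<sigma> * z t)" by (rule lip_cmult, rule lip_subset[OF z_lip[of t]]) (use x in auto)
    then have "k * (t - x) \<le> \<sigma> * z t - \<sigma> * z x"
    proof (rule abs_continuous_increment_ge[OF lip_abs_continuous])
      show "x \<le> t" using t by simp
      show "AE s in lebesgue. s \<in> {x<..<t} \<longrightarrow> (\<exists>D. ((\<lambda>t. \<sigma> * z t) has_real_derivative D) (at s) \<and> k \<le> D)"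
        using ae
      proof eventually_elim
        case (elim s)
        show ?case
        proof
          assume s: "s \<in> {x<..<t}"
          then have el: "0 < v s" "v s \<le> f s" "(z has_real_derivative w s / v s) (at s)"
            using elim x by auto
          have "f s \<le> f (x + e)" using s t x by (intro f_le) auto
          then have "m / f (x + e) \<le> (\<sigma> * w s) / v s"
            using wm[of s] s t el m by (intro frac_le) auto
          moreover have "((\<lambda>t. \<sigma> * z t) has_real_derivative (\<sigma> * w s) / v s) (at s)"
            using DERIV_cmult[OF el(3), of \<sigma>] by simp
          ultimately show "\<exists>D. ((\<lambda>t. \<sigma> * z t) has_real_derivative D) (at s) \<and> k \<le> D"
            unfolding k_def by blast
        qed
      qed
    qed
    moreover have "k * (t - x) > 0" using k t by simp
    ultimately show ?thesis using x by auto
  qed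
  then show ?thesis using e by blast
qed

section \<open>The Riccati variable on a zero-free interval\<close>

definition y :: "real \<Rightarrow> real" where "y t = - w t / z t"

context
  fixes \<tau> e :: real
  assumes \<tau>: "t0 \<le> \<tau>" and nz: "\<And>t. t \<in> {\<tau><..<e} \<Longrightarrow> z t \<noteq> 0"
begin

text \<open>\<open>z\<close> may vanish at \<open>\<tau>\<close> and at \<open>e\<close>, where
  \<open>y\<close> then blows up; hence the strict inequalities here and in the estimates
  below.\<close>

lemma y_lip: "\<tau> < p \<Longrightarrow> q < e \<Longrightarrow> lip p q y"
proof -
  assume pq: "\<tau> < p" "q < e"
  have sub: "{p..q} \<subseteq> {t0..q}" using pq \<tau> by auto
  have "lip p q (\<lambda>t. 1 / z t)"
    by (rule lip_inverse[OF lip_subset[OF z_lip sub]]) (use nz pq in auto)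
  then have "lip p q (\<lambda>t. (- 1 * w t) * (1 / z t))"
    by (intro lip_mult lip_cmult lip_subset[OF w_lip sub])
  then show ?thesis unfolding y_def by simp
qed

lemma y_ae: "AE t in lebesgue. t \<in> {\<tau><..<e} \<longrightarrow> 0 < v t \<and> v t \<le> f t \<and> 0 \<le> A t \<and>
   c / 2 * (f' t / f t) \<le> sqrt (A t) \<and> (y has_real_derivative A t * v t + (y t)\<^sup>2 / v t) (at t)"
  using ae
proof eventually_elim
  case (elim t)
  show ?case
  proof
    assume t: "t \<in> {\<tau><..<e}"
    then have "t \<in> {t0<..}" using \<tau> by auto
    then have el: "0 < v t" "v t \<le> f t" "0 \<le> A t" "c / 2 * (f' t / f t) \<le> sqrt (A t)"
       "(z has_real_derivative w t / v t) (at t)"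
       "(w has_real_derivative - (A t * v t * z t)) (at t)" using elim by auto
    have "(y has_real_derivative A t * v t + (y t)\<^sup>2 / v t) (at t)"
      unfolding y_def
      by (rule derivative_eq_intros el(5,6) refl)+
         (use nz[OF t] el(1) in \<open>simp_all add: field_simps power2_eq_square\<close>)
    then show "0 < v t \<and> v t \<le> f t \<and> 0 \<le> A t \<and>
       c / 2 * (f' t / f t) \<le> sqrt (A t) \<and> (y has_real_derivative A t * v t + (y t)\<^sup>2 / v t) (at t)"
      using el by blast
  qed
qed

lemma y_mono: "\<tau> < p \<Longrightarrow> p \<le> q \<Longrightarrow> q < e \<Longrightarrow> y p \<le> y q"
proof -
  assume pq: "\<tau> < p" "p \<le> q" "q < e"
  have "0 * (q - p) \<le> y q - y p"
  proof (rule abs_continuous_increment_ge[OF lip_abs_continuous[OF y_lip[OF pq(1,3)]] pq(2)])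
    show "AE t in lebesgue. t \<in> {p<..<q} \<longrightarrow> (\<exists>D. (y has_real_derivative D) (at t) \<and> 0 \<le> D)"
      using y_ae
    proof eventually_elim
      case (elim t)
      then show ?case using pq by (auto intro!: exI[of _ "A t * v t + (y t)\<^sup>2 / v t"])
    qed
  qed
  then show ?thesis by simp
qed

text \<open>AM-GM: \<open>A v + y\<^sup>2 / v \<ge> 2 sqrt A \<bar>y\<bar> \<ge> c \<bar>y\<bar> f' / f\<close>.\<close>
lemma ln_y_increment:
  assumes pq: "\<tau> < p" "p \<le> q" "q < e" and \<sigma>: "\<bar>\<sigma>\<bar> = 1" and pos: "\<And>t. t \<in> {p..q} \<Longrightarrow> 0 < \<sigma> * y t"
  shows "c * (ln (f q) - ln (f p)) \<le> \<sigma> * (ln (\<sigma> * y q) - ln (\<sigma> * y p))"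
proof -
  \<comment> \<open>\<open>\<sigma>\<close> is the sign of \<open>y\<close>, so both phases share
    one proof. The outer factor \<open>\<sigma>\<close> makes the derivative of the first term equal
    to \<open>y' / \<bar>y\<bar>\<close>, nonnegative in either case.\<close>
  define u where "u t = \<sigma> * ln (\<sigma> * y t) + (- c) * ln (f t)" for t
  have \<sigma>1: "\<sigma> = 1 \<or> \<sigma> = - 1" using \<sigma> by linarith
  have \<sigma>2: "\<sigma> * \<sigma> = 1" using \<sigma> by (metis abs_mult_self_eq mult_1)
  have "lip p q u" unfolding u_def
    by (intro lip_add lip_cmult lip_ln_f lip_ln y_lip) (use pq \<tau> pos in auto)
  then have "0 * (q - p) \<le> u q - u p"
  proof (rule abs_continuous_increment_ge[OF lip_abs_continuous _ ])
    show "p \<le> q" by (rule pq)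
    show "AE t in lebesgue. t \<in> {p<..<q} \<longrightarrow> (\<exists>D. (u has_real_derivative D) (at t) \<and> 0 \<le> D)"
      using y_ae
    proof eventually_elim
      case (elim t)
      show ?case
      proof
        assume t: "t \<in> {p<..<q}"
        define Y where "Y = A t * v t + (y t)\<^sup>2 / v t"
        have el: "0 < v t" "0 \<le> A t" "c / 2 * (f' t / f t) \<le> sqrt (A t)"
          "(y has_real_derivative Y) (at t)" using elim t pq by (auto simp: Y_def)
        have ft: "f t > 0" "(f has_real_derivative f' t) (at t)"
          using t pq \<tau> f_pos f_deriv_at by auto
        have yp: "0 < \<sigma> * y t" using pos t by auto
        have "(u has_real_derivative Y / (\<sigma> * y t) - c * (f' t / f t)) (at t)"
          unfolding u_def
          by (rule derivative_eq_intros el(4) ft yp refl)+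
             (use \<sigma>1 yp ft in \<open>elim disjE; simp add: field_simps\<close>)
        moreover have "c * (f' t / f t) \<le> Y / (\<sigma> * y t)"
        proof -
          have sy: "(\<sigma> * y t)\<^sup>2 = (y t)\<^sup>2" using \<sigma>2 by (simp add: power2_eq_square algebra_simps)
          have "2 * (sqrt (A t) * v t) * (\<sigma> * y t) \<le> (sqrt (A t) * v t)\<^sup>2 + (\<sigma> * y t)\<^sup>2"
            by (rule sum_squares_bound)
          also have "\<dots> = A t * v t * v t + (y t)\<^sup>2"
            using el(2) sy by (simp add: power_mult_distrib power2_eq_square[of "v t"])
          finally have "2 * sqrt (A t) * v t * (\<sigma> * y t) \<le> A t * v t * v t + (y t)\<^sup>2"
            by (simp add: mult.assoc)
          then have "2 * sqrt (A t) * (\<sigma> * y t) \<le> Y"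
            unfolding Y_def using el(1) by (simp add: field_simps)
          then have "2 * sqrt (A t) \<le> Y / (\<sigma> * y t)" using yp by (simp add: pos_le_divide_eq)
          moreover have "c * (f' t / f t) \<le> 2 * sqrt (A t)" using mult_left_mono[OF el(3), of 2] by simp
          ultimately show ?thesis by linarith
        qed
        ultimately show "\<exists>D. (u has_real_derivative D) (at t) \<and> 0 \<le> D"
          by (intro exI[of _ "Y / (\<sigma> * y t) - c * (f' t / f t)"]) simp
      qed
    qed
  qed
  then show ?thesis unfolding u_def by (simp add: algebra_simps)
qed

text \<open>Dropping \<open>A v\<close> from the Riccati equation leaves
  \<open>(- 1 / y)' \<ge> 1 / v\<close>, and \<open>v \<le> f \<le> f q\<close> on the
  interval.\<close>

lemma inverse_y_increment:
  assumes pq: "\<tau> < p" "p \<le> q" "q < e" and y0: "\<And>t. t \<in> {p..q} \<Longrightarrow> y t \<noteq> 0"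
  shows "(q - p) / f q \<le> 1 / y p - 1 / y q"
proof -
  define u where "u t = (- 1) * (1 / y t)" for t
  have "lip p q u" unfolding u_def
    by (intro lip_cmult lip_inverse y_lip) (use pq y0 in auto)
  then have "1 / f q * (q - p) \<le> u q - u p"
  proof (rule abs_continuous_increment_ge[OF lip_abs_continuous])
    show "p \<le> q" by (rule pq)
    show "AE t in lebesgue. t \<in> {p<..<q} \<longrightarrow> (\<exists>D. (u has_real_derivative D) (at t) \<and> 1 / f q \<le> D)"
      using y_ae
    proof eventually_elim
      case (elim t)
      show ?case
      proof
        assume t: "t \<in> {p<..<q}"
        define Y where "Y = A t * v t + (y t)\<^sup>2 / v t"
        have el: "0 < v t" "v t \<le> f t" "0 \<le> A t"
          "(y has_real_derivative Y) (at t)" using elim t pq by (auto simp: Y_def)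
        have y0t: "y t \<noteq> 0" using y0 t by auto
        have "(u has_real_derivative Y / (y t)\<^sup>2) (at t)"
          unfolding u_def
          by (rule derivative_eq_intros el(4) y0t refl)+ (simp add: y0t power2_eq_square)
        moreover have "1 / f q \<le> 1 / v t"
          using f_le[of t q] t pq \<tau> el by (intro frac_le) auto
        moreover have "1 / v t \<le> Y / (y t)\<^sup>2"
          using el y0t by (simp add: Y_def field_simps)
        ultimately show "\<exists>D. (u has_real_derivative D) (at t) \<and> 1 / f q \<le> D"
          by (intro exI[of _ "Y / (y t)\<^sup>2"]) simp
      qed
    qed
  qed
  then show ?thesis unfolding u_def by simp
qed

text \<open>Since \<open>A v + 1 / v \<ge> 2 sqrt A\<close>, the equation pushes \<open>y\<close> upwards even where \<open>y\<close> is small.\<close>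
lemma y_increment:
  assumes pq: "\<tau> < p" "p \<le> q" "q < e" and int: "(\<lambda>t. 1 / v t) integrable_on {p..q}"
  shows "c * (ln (f q) - ln (f p)) - integral {p..q} (\<lambda>t. 1 / v t) \<le> y q - y p"
proof -
  define u where "u t = y t + (- c) * ln (f t)" for t
  have "lip p q u" unfolding u_def
    by (intro lip_add lip_cmult lip_ln_f y_lip) (use pq \<tau> in auto)
  then have "integral {p..q} (\<lambda>t. - (1 / v t)) \<le> u q - u p"
  proof (rule integral_le_increment[OF lip_abs_continuous])
    show "p \<le> q" by (rule pq)
    show "(\<lambda>t. - (1 / v t)) integrable_on {p..q}" using int by (rule integrable_neg)
    show "AE t\<in>{p<..<q} in lebesgue. \<exists>D. (u has_real_derivative D) (at t) \<and> - (1 / v t) \<le> D"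
      using y_ae
    proof eventually_elim
      case (elim t)
      show ?case
      proof
        assume t: "t \<in> {p<..<q}"
        define Y where "Y = A t * v t + (y t)\<^sup>2 / v t"
        have el: "0 < v t" "0 \<le> A t" "c / 2 * (f' t / f t) \<le> sqrt (A t)"
          "(y has_real_derivative Y) (at t)" using elim t pq by (auto simp: Y_def)
        have ft: "f t > 0" "(f has_real_derivative f' t) (at t)"
          using t pq \<tau> f_pos f_deriv_at by auto
        have "(u has_real_derivative Y - c * (f' t / f t)) (at t)"
          unfolding u_def
          by (rule derivative_eq_intros el(4) ft refl)+ (use ft in \<open>simp add: field_simps\<close>)
        moreover have "c * (f' t / f t) - 1 / v t \<le> Y"
        proof -
          have "0 \<le> (sqrt (A t) * v t - 1)\<^sup>2" by simp
          then have "2 * sqrt (A t) * v t \<le> A t * v t * v t + 1"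
            using el(2) by (simp add: power2_diff power_mult_distrib) (simp add: power2_eq_square algebra_simps)
          then have "2 * sqrt (A t) - 1 / v t \<le> A t * v t" using el(1) by (simp add: field_simps)
          moreover have "0 \<le> (y t)\<^sup>2 / v t" using el(1) by simp
          ultimately show ?thesis unfolding Y_def using el(3) by simp
        qed
        ultimately show "\<exists>D. (u has_real_derivative D) (at t) \<and> - (1 / v t) \<le> D"
          by (intro exI[of _ "Y - c * (f' t / f t)"]) simp
      qed
    qed
  qed
  then show ?thesis unfolding u_def by (simp add: algebra_simps)
qed

text \<open>Before \<open>m\<close> the bound on \<open>- 1 / y\<close> gives
  \<open>(m - p) * \<bar>y m\<bar> \<le> f m\<close>; after \<open>m\<close> the logarithmic bound
  forces \<open>\<bar>y m\<bar> \<ge> (f s / f m) powr c\<close>, because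
  \<open>\<bar>y\<bar>\<close> is still at least 1 at \<open>s\<close>. The product of the two is
  the quotient of \<open>classA\<close> with \<open>t = \<tau>\<close>, \<open>h = 0\<close>,
  \<open>g = s - \<tau>\<close> and \<open>m = \<tau> + (1 - \<xi>) * g\<close>.\<close>

lemma negative_phase:
  assumes ms: "\<tau> < m" "m \<le> s" "s < e" and ys: "y s \<le> - 1"
  shows "(m - \<tau>) * f s powr c / f m powr (c + 1) \<le> 2"
proof -
  \<comment> \<open>\<open>y\<close> is controlled only strictly after \<open>\<tau>\<close>.
    Starting at the midpoint costs a factor 2, which is the constant in the claim.\<close>
  define p where "p = (\<tau> + m) / 2"
  have p: "\<tau> < p" "p \<le> m" "m - p = (m - \<tau>) / 2" using ms by (auto simp: p_def field_simps)
  have neg: "y t \<le> - 1" if "t \<in> {p..s}" for t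
    using y_mono[of t s] that p ms ys by auto
  have fm: "f m > 0" "f s > 0" using f_pos \<tau> ms by auto
  have me: "m < e" using ms by simp
  have "(m - p) / f m \<le> 1 / y p - 1 / y m"
    by (rule inverse_y_increment[OF p(1,2) me]) (use neg ms in force)
  moreover have "1 / y p \<le> 0" using neg[of p] p ms by (simp add: divide_nonpos_neg)
  ultimately have "(m - p) / f m \<le> - (1 / y m)" by linarith
  then have "(m - p) / f m \<le> 1 / (- y m)" by simp
  moreover have "0 < - y m" using neg[of m] p ms by simp
  moreover have "a * r \<le> F" if "a / F \<le> 1 / r" "0 < F" "0 < r" for a F r :: real
    using that by (simp add: field_simps)
  ultimately have "(m - p) * (- y m) \<le> f m" using fm(1) by blast
  then have A: "(m - \<tau>) * (- y m) \<le> 2 * f m" using p(3) by simp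
  have "c * (ln (f s) - ln (f m)) \<le> (- 1) * (ln (- 1 * y s) - ln (- 1 * y m))"
  proof (rule ln_y_increment[OF ms(1,2,3)])
    show "0 < - 1 * y t" if "t \<in> {m..s}" for t using neg[of t] that p(2) by simp
  qed simp
  moreover have "0 \<le> ln (- y s)" using ys by simp
  ultimately have "c * (ln (f s) - ln (f m)) \<le> ln (- y m)" by simp
  then have "exp (c * (ln (f s) - ln (f m))) \<le> - y m"
    using neg[of m] p ms by (simp add: ln_ge_iff)
  moreover have "exp (c * (ln (f s) - ln (f m))) = f s powr c / f m powr c"
    using fm by (simp add: powr_def exp_diff right_diff_distrib)
  ultimately have "(m - \<tau>) * (f s powr c / f m powr c) \<le> (m - \<tau>) * (- y m)"
    using ms by (intro mult_left_mono) auto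
  then have "(m - \<tau>) * (f s powr c / f m powr c) \<le> 2 * f m" using A by simp
  then have "(m - \<tau>) * f s powr c / f m powr c / f m \<le> 2"
    using fm by (simp add: divide_le_eq mult_ac)
  then show ?thesis using fm by (simp add: powr_add mult_ac)
qed

text \<open>The mirror image: the logarithmic bound makes \<open>y m\<close> at least
  \<open>(f m / f p) powr c\<close>, and such a large value leaves at most \<open>f s / y m\<close>
  of time up to \<open>s\<close>. This is the quotient of \<open>classB\<close> with
  \<open>p = t + k\<close>, \<open>s = t + g + k\<close> and
  \<open>s - m = \<xi> * g\<close>.\<close>

lemma positive_phase:
  assumes pms: "\<tau> < p" "p \<le> m" "m \<le> s" "s < e" and yp: "1 \<le> y p"
  shows "(s - m) * f m powr c / (f s * f p powr c) \<le> 1"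
proof -
  have pos: "1 \<le> y t" if "t \<in> {p..s}" for t
    using y_mono[of p t] that pms yp by auto
  have fm: "f m > 0" "f s > 0" "f p > 0" using f_pos \<tau> pms by auto
  have "(s - m) / f s \<le> 1 / y m - 1 / y s"
  proof (rule inverse_y_increment)
    show "y t \<noteq> 0" if "t \<in> {m..s}" for t using pos[of t] that pms(2) by simp
  qed (use pms in auto)
  moreover have "0 \<le> 1 / y s" using pos[of s] pms by simp
  ultimately have "(s - m) / f s \<le> 1 / y m" by linarith
  then have A: "(s - m) * y m \<le> f s"
    using fm pos[of m] pms by (simp add: field_simps)
  have "c * (ln (f m) - ln (f p)) \<le> 1 * (ln (1 * y m) - ln (1 * y p))"
  proof (rule ln_y_increment)
    show "0 < 1 * y t" if "t \<in> {p..m}" for t using pos[of t] that pms(3) by simp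
  qed (use pms in auto)
  moreover have "0 \<le> ln (y p)" using yp by simp
  ultimately have "c * (ln (f m) - ln (f p)) \<le> ln (y m)" by simp
  then have "exp (c * (ln (f m) - ln (f p))) \<le> y m"
    using pos[of m] pms by (simp add: ln_ge_iff)
  moreover have "exp (c * (ln (f m) - ln (f p))) = f m powr c / f p powr c"
    using fm by (simp add: powr_def exp_diff right_diff_distrib)
  ultimately have "(s - m) * (f m powr c / f p powr c) \<le> (s - m) * y m"
    using pms by (intro mult_left_mono) auto
  then have "(s - m) * (f m powr c / f p powr c) \<le> f s" using A by simp
  then show ?thesis using fm by (simp add: divide_le_eq mult.commute)
qed

end

end

section \<open>Length of intervals free of zeros\<close>

text \<open>\<open>LEAST\<close> on the reals is meaningful only where a minimum exists.
  \<open>P\<close> is kept apart from \<open>S\<close> because the condition for the second zero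
  involves a strict inequality and is merely equivalent to membership in a closed set.\<close>

lemma Least_closed_real:
  fixes S :: "real set"
  assumes S: "closed S" "S \<noteq> {}" "S \<subseteq> {a..}" and P: "\<And>t. P t \<longleftrightarrow> t \<in> S"
  shows "P (LEAST t. P t) \<and> (\<forall>t. P t \<longrightarrow> (LEAST t. P t) \<le> t)"
proof -
  have bdd: "bdd_below S" using S(3) by (meson atLeast_iff bdd_belowI subset_iff)
  have "Inf S \<in> S" by (rule closed_contains_Inf[OF S(2) bdd S(1)])
  moreover have "(LEAST t. P t) = Inf S"
    using calculation P cInf_lower[OF _ bdd] by (intro Least_equality) auto
  ultimately show ?thesis using P cInf_lower[OF _ bdd] by auto
qed

locale dominated_equation_P = dominated_equation +
  fixes D \<mu> :: real
  assumes P: "property_P t0 f c"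
    and t0_pos: "t0 > 0" and D_pos: "D > 0" and \<mu>: "\<mu> < 1"
    and growth: "\<And>t. t \<ge> t0 \<Longrightarrow> f' t / f t \<ge> 1 / (D * t powr \<mu>)"
    and int_v: "\<exists>R M. \<forall>p\<ge>R. \<forall>q\<ge>p. (\<lambda>t. 1 / v t) integrable_on {p..q} \<and>
        integral {p..q} (\<lambda>t. 1 / v t) \<le> M"
begin

text \<open>The interval is open, so that it may stretch from one zero to the next.\<close>

definition zero_free :: "real \<Rightarrow> real \<Rightarrow> bool" where
  "zero_free a b \<longleftrightarrow> (\<forall>t\<in>{a<..<b}. z t \<noteq> 0)"

text \<open>By the mean value theorem the increment is \<open>(l - 1) * p * (f' t / f t)\<close> for
  some \<open>t\<close> between \<open>p\<close> and \<open>l * p\<close>, hence at least a multiple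
  of \<open>p powr (1 - \<mu>)\<close>, which is unbounded as \<open>\<mu> < 1\<close>.\<close>

lemma ln_f_growth:
  assumes l: "l > 1"
  shows "\<exists>R\<ge>t0. \<forall>p\<ge>R. M \<le> ln (f (l * p)) - ln (f p)"
proof -
  \<comment> \<open>\<open>t / p\<close> lies between 1 and \<open>l\<close>, so
    \<open>t powr \<mu>\<close> is at most \<open>l powr \<bar>\<mu>\<bar> * p powr \<mu>\<close>
    whatever the sign of \<open>\<mu>\<close>.\<close>
  define C where "C = (l - 1) / (D * l powr \<bar>\<mu>\<bar>)"
  have C: "C > 0" using l D_pos by (simp add: C_def)
  have "filterlim (\<lambda>p. C * p powr (1 - \<mu>)) at_top at_top"
    using C \<mu> by real_asymp
  then obtain R0 where R0: "\<forall>p\<ge>R0. M \<le> C * p powr (1 - \<mu>)"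
    unfolding filterlim_at_top eventually_at_top_linorder by blast
  have "M \<le> ln (f (l * p)) - ln (f p)" if p: "p \<ge> max R0 t0" for p
  proof -
    have p0: "p \<ge> t0" "p > 0" "p < l * p" using p t0_pos l by auto
    have der: "((\<lambda>t. ln (f t)) has_real_derivative f' x / f x) (at x)" if "p < x" for x
    proof -
      have "f x > 0" "(f has_real_derivative f' x) (at x)"
        using that p0 f_pos f_deriv_at by auto
      then show ?thesis by (auto intro!: derivative_eq_intros)
    qed
    have "\<exists>k t. p < t \<and> t < l * p \<and> ((\<lambda>t. ln (f t)) has_real_derivative k) (at t) \<and>
        ln (f (l * p)) - ln (f p) = (l * p - p) * k"
    proof (rule MVT[OF p0(3)])
      show "continuous_on {p..l * p} (\<lambda>t. ln (f t))"
        by (rule lip_continuous_on[OF lip_ln_f[OF p0(1)]])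
      show "(\<lambda>t. ln (f t)) differentiable (at x)" if "p < x" "x < l * p" for x
        using der[OF that(1)] real_differentiable_def by blast
    qed
    then obtain k t where t: "p < t" "t < l * p" and "((\<lambda>t. ln (f t)) has_real_derivative k) (at t)"
      and eqk: "ln (f (l * p)) - ln (f p) = (l * p - p) * k" by (elim exE conjE)
    then have eq: "ln (f (l * p)) - ln (f p) = (l * p - p) * (f' t / f t)"
      using DERIV_unique[OF der[OF t(1)]] by metis
    have tp: "t / p \<ge> 1" "t / p \<le> l" using t p0 by (auto simp: divide_le_eq)
    have "t powr \<mu> = (t / p) powr \<mu> * p powr \<mu>" using t p0 by (simp add: powr_divide)
    also have "\<dots> \<le> l powr \<bar>\<mu>\<bar> * p powr \<mu>"
    proof (rule mult_right_mono)
      have "(t / p) powr \<mu> \<le> (t / p) powr \<bar>\<mu>\<bar>" using tp by (intro powr_mono) auto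
      also have "\<dots> \<le> l powr \<bar>\<mu>\<bar>" using tp by (intro powr_mono2) auto
      finally show "(t / p) powr \<mu> \<le> l powr \<bar>\<mu>\<bar>" .
    qed simp
    finally have "1 / (D * (l powr \<bar>\<mu>\<bar> * p powr \<mu>)) \<le> 1 / (D * t powr \<mu>)"
      using D_pos t p0 l by (intro frac_le mult_left_mono) auto
    also have "\<dots> \<le> f' t / f t" using growth[of t] t p0 by simp
    finally have "(l * p - p) * (1 / (D * (l powr \<bar>\<mu>\<bar> * p powr \<mu>))) \<le> (l * p - p) * (f' t / f t)"
      using p0 by (intro mult_left_mono) auto
    moreover have "(l * p - p) * (1 / (D * (l powr \<bar>\<mu>\<bar> * p powr \<mu>))) = C * (p / p powr \<mu>)"
      by (simp add: C_def algebra_simps diff_divide_distrib)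
    moreover have "p / p powr \<mu> = p powr (1 - \<mu>)" using p0 by (simp add: powr_diff)
    ultimately show ?thesis using R0 p eq by force
  qed
  then show ?thesis by (intro exI[of _ "max R0 t0"]) auto
qed

text \<open>It suffices that \<open>y\<close> gain 2. The gain is at least \<open>c\<close> times
  the increment of \<open>ln f\<close> less \<open>M\<close>, and that increment exceeds any bound
  on \<open>{p..l * p}\<close>. As \<open>l\<close> may be any number above 1, the crossing costs
  nothing asymptotically.\<close>

lemma crossing_phase:
  assumes l: "l > 1"
  shows "\<exists>R\<ge>t0. \<forall>\<tau>\<ge>R. \<forall>e p. zero_free \<tau> e \<longrightarrow> \<tau> < p \<longrightarrow> l * p < e \<longrightarrow> - 1 < y p \<longrightarrow> 1 \<le> y (l * p)"
proof -
  obtain R1 M where R1: "\<forall>p\<ge>R1. \<forall>q\<ge>p. (\<lambda>t. 1 / v t) integrable_on {p..q} \<and>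
        integral {p..q} (\<lambda>t. 1 / v t) \<le> M" using int_v by blast
  obtain R2 where R2: "R2 \<ge> t0" "\<forall>p\<ge>R2. (2 + M) / c \<le> ln (f (l * p)) - ln (f p)"
    using ln_f_growth[OF l] by blast
  have "1 \<le> y (l * p)" if \<tau>: "max R1 R2 \<le> \<tau>" and zf: "zero_free \<tau> e"
    and p: "\<tau> < p" "l * p < e" "- 1 < y p" for \<tau> e p
  proof -
    have \<tau>0: "t0 \<le> \<tau>" using \<tau> R2 by simp
    have nz: "\<And>t. t \<in> {\<tau><..<e} \<Longrightarrow> z t \<noteq> 0" using zf zero_free_def by blast
    have lp: "p \<le> l * p" using l p \<tau>0 t0_pos by simp
    have int: "(\<lambda>t. 1 / v t) integrable_on {p..l * p}" "integral {p..l * p} (\<lambda>t. 1 / v t) \<le> M"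
      using R1 \<tau> p lp by auto
    have "c * (ln (f (l * p)) - ln (f p)) - integral {p..l * p} (\<lambda>t. 1 / v t) \<le> y (l * p) - y p"
      by (rule y_increment[OF \<tau>0 nz p(1) lp p(2) int(1)])
    moreover have "2 + M \<le> c * (ln (f (l * p)) - ln (f p))"
    proof -
      have "(2 + M) / c \<le> ln (f (l * p)) - ln (f p)" using R2(2) \<tau> p by auto
      then show ?thesis using c_pos by (simp only: pos_divide_le_eq mult.commute[of c])
    qed
    ultimately show ?thesis using int(2) p(3) by linarith
  qed
  then show ?thesis using R2(1) by (intro exI[of _ "max R1 R2"]) auto
qed

lemma zero_free_bound:
  "\<exists>K R. R \<ge> t0 \<and> (\<forall>\<tau>\<ge>R. \<forall>e. zero_free \<tau> e \<longrightarrow> e \<le> K * \<tau>)"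
proof -
  obtain K1 R1 where K1: "\<forall>t\<ge>R1. \<forall>g\<ge>0. (\<forall>\<xi>\<in>{0<..<1}. (1 - \<xi>) * g * f (t + g) powr c
              / f (t + (1 - \<xi>) * g) powr (c + 1) \<le> 2) \<longrightarrow> g \<le> K1 * t"
    using property_P_uniform_A[OF P, of 2] by (elim exE)
  \<comment> \<open>Chosen so that \<open>a - 1 > K1\<close>: a negative phase lasting until
    \<open>a * \<tau>\<close> would contradict (P). Likewise \<open>b > K3\<close> below, while the
    doubling \<open>2 * a\<close> pays for the crossing.\<close>
  define a where "a = max K1 0 + 2"
  obtain R2 where R2: "R2 \<ge> t0" "\<forall>\<tau>\<ge>R2. \<forall>e p. zero_free \<tau> e \<longrightarrow> \<tau> < p \<longrightarrow> 2 * p < e \<longrightarrow> - 1 < y p \<longrightarrow> 1 \<le> y (2 * p)"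
    using crossing_phase[of 2] by auto
  obtain K3 R3 where K3: "\<forall>t\<ge>R3. \<forall>k g. 0 \<le> k \<longrightarrow> k \<le> (2 * a) * t \<longrightarrow> 0 \<le> g \<longrightarrow>
      (\<forall>\<xi>\<in>{0<..<1}. \<xi> * g * f (t + (1 - \<xi>) * g + k) powr c
              / (f (t + g + k) * f (t + k) powr c) \<le> 1) \<longrightarrow> g \<le> K3 * t"
    using property_P_uniform_B[OF P, of "2 * a" 1] by (elim exE)
  define b where "b = max K3 0 + 1"
  have ab: "a \<ge> 2" "a > K1 + 1" "b \<ge> 1" "b > K3" by (auto simp: a_def b_def)
  have "e \<le> (2 * a + b) * \<tau>" if \<tau>: "\<tau> \<ge> max R1 (max R2 R3)" and zf: "zero_free \<tau> e" for \<tau> e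
  proof (rule ccontr)
    assume "\<not> e \<le> (2 * a + b) * \<tau>"
    then have e: "(2 * a + b) * \<tau> < e" by simp
    have \<tau>0: "t0 \<le> \<tau>" "0 < \<tau>" using \<tau> R2 t0_pos by auto
    have nz: "\<And>t. t \<in> {\<tau><..<e} \<Longrightarrow> z t \<noteq> 0" using zf zero_free_def by blast
    have ord: "\<tau> < a * \<tau>" "a * \<tau> < 2 * (a * \<tau>)" "2 * (a * \<tau>) < (2 * a + b) * \<tau>"
      using ab \<tau>0 by (auto simp: distrib_right)
    have ea: "a * \<tau> < e" "2 * (a * \<tau>) < e" using ord e by linarith+
    have "- 1 < y (a * \<tau>)"
    proof (rule ccontr)
      assume "\<not> - 1 < y (a * \<tau>)"
      then have ya: "y (a * \<tau>) \<le> - 1" by simp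
      define g where "g = a * \<tau> - \<tau>"
      have g: "g > 0" "\<tau> + g = a * \<tau>" using ord by (auto simp: g_def)
      have "(1 - \<xi>) * g * f (\<tau> + g) powr c / f (\<tau> + (1 - \<xi>) * g) powr (c + 1) \<le> 2"
        if \<xi>: "\<xi> \<in> {0<..<1}" for \<xi>
      proof -
        have m: "\<tau> < \<tau> + (1 - \<xi>) * g" "\<tau> + (1 - \<xi>) * g \<le> a * \<tau>"
          using \<xi> g(1) by (simp_all add: g(2)[symmetric] mult_le_cancel_right1)
        show ?thesis using negative_phase[OF \<tau>0(1) nz m ea(1) ya] g(2) by simp
      qed
      then have "g \<le> K1 * \<tau>" using K1 \<tau> g(1) by auto
      then have "(a - 1) * \<tau> \<le> K1 * \<tau>" by (simp add: g_def left_diff_distrib)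
      then show False using ab \<tau>0 by simp
    qed
    then have yp: "1 \<le> y (2 * (a * \<tau>))" using R2(2) \<tau> zf ord(1) ea(2) by auto
    define g where "g = b * \<tau>"
    \<comment> \<open>Time is still counted from \<open>\<tau>\<close>; the supposed positive phase
      is the interval from \<open>\<tau> + k\<close> to \<open>\<tau> + k + g\<close>, which
      explains the bound \<open>2 * a\<close> on the shift.\<close>
    define k where "k = 2 * (a * \<tau>) - \<tau>"
    have g: "g > 0" using ab \<tau>0 by (simp add: g_def)
    have kg: "\<tau> + k = 2 * (a * \<tau>)" "\<tau> + g + k = (2 * a + b) * \<tau>"
      by (auto simp: k_def g_def algebra_simps)
    have "\<xi> * g * f (\<tau> + (1 - \<xi>) * g + k) powr c / (f (\<tau> + g + k) * f (\<tau> + k) powr c) \<le> 1"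
      if \<xi>: "\<xi> \<in> {0<..<1}" for \<xi>
    proof -
      define m where "m = \<tau> + (1 - \<xi>) * g + k"
      have "0 \<le> (1 - \<xi>) * g" "(1 - \<xi>) * g \<le> g"
        using \<xi> g by (simp_all add: mult_le_cancel_right1)
      then have m: "\<tau> + k \<le> m" "m \<le> \<tau> + g + k" by (auto simp: m_def)
      have sm: "\<tau> + g + k - m = \<xi> * g" by (simp add: m_def algebra_simps)
      have "\<tau> < \<tau> + k" using kg ord by linarith
      moreover have "\<tau> + g + k < e" using kg e by linarith
      moreover have "1 \<le> y (\<tau> + k)" using kg yp by simp
      ultimately have "(\<tau> + g + k - m) * f m powr c / (f (\<tau> + g + k) * f (\<tau> + k) powr c) \<le> 1"
        using m by (intro positive_phase[OF \<tau>0(1) nz])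
      then have "\<xi> * g * f m powr c / (f (\<tau> + g + k) * f (\<tau> + k) powr c) \<le> 1" by (simp only: sm)
      then show ?thesis by (simp only: m_def)
    qed
    moreover have "0 \<le> k" "k \<le> (2 * a) * \<tau>" using ord \<tau>0 by (auto simp: k_def)
    ultimately have "g \<le> K3 * \<tau>" using K3 \<tau> g by auto
    then show False using ab \<tau>0 by (simp add: g_def)
  qed
  then show ?thesis using R2(1) by (intro exI[of _ "2 * a + b"] exI[of _ "max R1 (max R2 R3)"]) auto
qed

text \<open>The length bound also supplies existence: without a zero after \<open>a\<close>, the
  interval up to \<open>L * a + 1\<close> would be zero-free. It is then used twice, from
  \<open>\<tau>\<close> to the first zero and from there to the second.\<close>

lemma consecutive_zeros_bound:
  assumes R: "R \<ge> t0" and bound: "\<forall>\<tau>\<ge>R. \<forall>e. zero_free \<tau> e \<longrightarrow> e \<le> L * \<tau>"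
    and \<tau>: "\<tau> \<ge> R"
    and x1: "x1 = (LEAST t. t \<ge> \<tau> \<and> z t = 0)" and x2: "x2 = (LEAST t. t > x1 \<and> z t = 0)"
  shows "\<tau> \<le> x1" "x1 < x2" "x2 \<le> L * (L * \<tau>)"
proof -
  have pos: "t > 0" "t \<ge> t0" if "t \<ge> R" for t using that R t0_pos by auto
  have closed: "closed {t \<in> {a..}. z t = 0}" if a: "a \<ge> R" for a
  proof -
    have "continuous_on {a..} z"
      unfolding continuous_on_iff
    proof (intro ballI allI impI)
      fix x \<epsilon> :: real assume x: "x \<in> {a..}" and \<epsilon>: "\<epsilon> > 0"
      have "x \<in> {t0..x + 1}" using x a R by auto
      then obtain d where d: "d > 0" "\<forall>t\<in>{t0..x + 1}. dist t x < d \<longrightarrow> dist (z t) (z x) < \<epsilon>"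
        using cont_z[of "x + 1"] \<epsilon> unfolding continuous_on_iff by blast
      have "dist (z t) (z x) < \<epsilon>" if "t \<in> {a..}" "dist t x < min d 1" for t
      proof -
        have "t \<in> {t0..x + 1}" using that a R by (auto simp: dist_real_def)
        then show ?thesis using d that by auto
      qed
      then show "\<exists>d>0. \<forall>x'\<in>{a..}. dist x' x < d \<longrightarrow> dist (z x') (z x) < \<epsilon>"
        using d(1) by (intro exI[of _ "min d 1"]) auto
    qed
    then have "closed ({a..} \<inter> z -` {0})" by (intro continuous_closed_preimage) auto
    moreover have "{t \<in> {a..}. z t = 0} = {a..} \<inter> z -` {0}" by auto
    ultimately show ?thesis by simp
  qed
  have ex: "\<exists>t\<ge>a. z t = 0" if a: "a \<ge> R" for a
  proof (rule ccontr)
    assume "\<not> ?thesis"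
    then have "zero_free a (L * a + 1)" by (auto simp: zero_free_def)
    then have "L * a + 1 \<le> L * a" using bound a by blast
    then show False by simp
  qed
  have x1p: "(x1 \<ge> \<tau> \<and> z x1 = 0) \<and> (\<forall>t. t \<ge> \<tau> \<and> z t = 0 \<longrightarrow> x1 \<le> t)"
    unfolding x1
    by (rule Least_closed_real[OF closed[OF \<tau>], of \<tau>]) (use ex[OF \<tau>] in auto)
  then show 1: "\<tau> \<le> x1" by simp
  have x1R: "x1 \<ge> R" using 1 \<tau> by simp
  obtain d where d: "d > 0" "\<forall>t\<in>{x1<..x1 + d}. z t \<noteq> 0"
    using zero_isolated_right[of x1] x1p pos(2)[OF x1R] by blast
  have xdR: "x1 + d \<ge> R" using x1R d by simp
  have x2p: "(x2 > x1 \<and> z x2 = 0) \<and> (\<forall>t. t > x1 \<and> z t = 0 \<longrightarrow> x2 \<le> t)"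
    unfolding x2
  \<comment> \<open>No zero lies in the first stretch of length \<open>d\<close> after
    \<open>x1\<close>, so the open condition \<open>t > x1\<close> may be replaced by a closed
    one.\<close>
  proof (rule Least_closed_real[OF closed[OF xdR], of "x1 + d"])
    show "x1 < t \<and> z t = 0 \<longleftrightarrow> t \<in> {t \<in> {x1 + d..}. z t = 0}" for t
      using d by (cases "t \<le> x1 + d") force+
  qed (use ex[OF xdR] in auto)
  then show 2: "x1 < x2" by simp
  have "zero_free x1 x2"
      unfolding zero_free_def
    proof
      fix t assume "t \<in> {x1<..<x2}"
      then show "z t \<noteq> 0" using x2p[THEN conjunct2, rule_format, of t] by auto
    qed
  then have x21: "x2 \<le> L * x1" using bound x1R by blast
  have L: "L \<ge> 1"
  proof -
    have "x1 < L * x1" using x21 2 by simp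
    then have "1 * x1 < L * x1" by simp
    then show ?thesis using pos(1)[OF x1R] by (simp only: mult_less_cancel_right_pos)
  qed
  have "x1 \<le> L * \<tau>"
  proof -
    have "zero_free \<tau> x1"
      unfolding zero_free_def
    proof
      fix t assume "t \<in> {\<tau><..<x1}"
      then show "z t \<noteq> 0" using x1p[THEN conjunct2, rule_format, of t] by auto
    qed
    then show ?thesis using bound \<tau> by blast
  qed
  then have "L * x1 \<le> L * (L * \<tau>)" using L by (intro mult_left_mono) auto
  with x21 show "x2 \<le> L * (L * \<tau>)" by simp
qed

end

section \<open>The case of exponential \<open>f\<close>\<close>

text \<open>\<open>ln f\<close> is regularly varying of index \<open>\<alpha>\<close>: the
  logarithmic factor varies slowly and \<open>ln \<Lambda>\<close> is negligible against the
  unbounded main term.\<close>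

lemma exponential_f_asymptotics:
  fixes f :: "real \<Rightarrow> real"
  assumes par: "\<Lambda> > 0" "a > 0" "\<alpha> > 0" "\<beta> \<ge> 0"
    and f: "\<And>t. t \<ge> t0 \<Longrightarrow> f t = \<Lambda> * exp (a * t powr \<alpha> * real_pow (ln t) \<beta>)"
  shows "\<And>l. l > 0 \<Longrightarrow> ((\<lambda>t. ln (f (l * t)) / ln (f t)) \<longlongrightarrow> l powr \<alpha>) at_top"
    and "\<forall>\<^sub>F t in at_top. 2 * ln t \<le> ln (f t)"
proof -
  define \<psi> where "\<psi> t = a * (t powr \<alpha> * ln t powr \<beta>)" for t :: real
  \<comment> \<open>\<open>real_pow\<close> and \<open>powr\<close> agree at positive base; the
    bound \<open>t \<ge> 2\<close> used below ensures \<open>ln t > 0\<close>.\<close>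
  have rp: "real_pow x b = x powr b" if "x > 0" "b \<ge> 0" for x b :: real
  proof (cases "b \<in> \<nat>")
    case True
    then obtain n where "b = real n" by (auto elim: Nats_cases)
    then show ?thesis using that by (simp add: real_pow_def powr_realpow)
  qed (simp add: real_pow_def)
  have lnf: "ln (f t) = ln \<Lambda> + \<psi> t" if "t \<ge> max t0 2" for t
  proof -
    have "ln t > 0" using that by simp
    then show ?thesis using that par by (simp add: f \<psi>_def rp ln_mult mult.assoc)
  qed
  have \<psi>_ge: "\<forall>\<^sub>F t in at_top. a * t powr \<alpha> \<le> \<psi> t"
    using eventually_ge_at_top[of "exp 1"]
  proof eventually_elim
    case (elim t)
    moreover have "0 < exp (1::real)" by simp
    ultimately have "ln t \<ge> 1" by (simp add: ln_ge_iff del: exp_gt_zero)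
    then have "1 \<le> ln t powr \<beta>" using par by (simp add: ge_one_powr_ge_zero)
    then have "t powr \<alpha> * 1 \<le> t powr \<alpha> * ln t powr \<beta>" by (intro mult_left_mono) auto
    then show ?case using par by (simp add: \<psi>_def)
  qed
  have "filterlim (\<lambda>t. a * t powr \<alpha>) at_top at_top" using par by real_asymp
  then have \<psi>_lim: "filterlim \<psi> at_top at_top"
    using filterlim_at_top_mono \<psi>_ge by blast
  then have \<psi>_pos: "\<forall>\<^sub>F t in at_top. \<psi> t > 0"
    using filterlim_at_top_dense by blast
  have "\<forall>\<^sub>F t in at_top. 2 * ln t \<le> ln \<Lambda> + a * t powr \<alpha>" using par by real_asymp
  then show "\<forall>\<^sub>F t in at_top. 2 * ln t \<le> ln (f t)"
    using \<psi>_ge eventually_ge_at_top[of "max t0 2"]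
  proof eventually_elim
    case (elim t)
    then show ?case using lnf[of t] by linarith
  qed
  show "((\<lambda>t. ln (f (l * t)) / ln (f t)) \<longlongrightarrow> l powr \<alpha>) at_top" if l: "l > 0" for l
  proof -
    have inv: "((\<lambda>t. ln \<Lambda> / \<psi> t) \<longlongrightarrow> 0) at_top"
      by (rule real_tendsto_divide_at_top[OF tendsto_const \<psi>_lim])
    have lim: "((\<lambda>t. ln (l * t) / ln t) \<longlongrightarrow> 1) at_top" using l by real_asymp
    have "((\<lambda>t. (ln (l * t) / ln t) powr \<beta>) \<longlongrightarrow> 1 powr \<beta>) at_top"
      by (rule tendsto_powr[OF lim tendsto_const]) simp
    note lim' = this
    \<comment> \<open>Numerator and denominator of the ratio are divided by
      \<open>\<psi> t\<close>.\<close>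
    have "((\<lambda>t. (ln \<Lambda> / \<psi> t + l powr \<alpha> * (ln (l * t) / ln t) powr \<beta>) / (ln \<Lambda> / \<psi> t + 1))
        \<longlongrightarrow> (0 + l powr \<alpha> * 1 powr \<beta>) / (0 + 1)) at_top"
      by (intro tendsto_intros inv lim') auto
    moreover have "\<forall>\<^sub>F t in at_top. (ln \<Lambda> / \<psi> t + l powr \<alpha> * (ln (l * t) / ln t) powr \<beta>) / (ln \<Lambda> / \<psi> t + 1)
        = ln (f (l * t)) / ln (f t)"
      using eventually_ge_at_top[of "max t0 2"] eventually_ge_at_top[of "max t0 2 / l"] \<psi>_pos
    proof eventually_elim
      case (elim t)
      have lt: "l * t \<ge> max t0 2" using elim(2) l by (simp add: divide_le_eq mult.commute)
      have pos: "ln t > 0" "ln (l * t) > 0" "t > 0" using elim lt by auto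
      have "\<psi> (l * t) / \<psi> t = l powr \<alpha> * (ln (l * t) / ln t) powr \<beta>"
        using pos l par by (simp add: \<psi>_def powr_mult powr_divide)
      then have "ln \<Lambda> / \<psi> t + l powr \<alpha> * (ln (l * t) / ln t) powr \<beta> = (ln \<Lambda> + \<psi> (l * t)) / \<psi> t"
        by (simp add: add_divide_distrib)
      moreover have "ln \<Lambda> / \<psi> t + 1 = (ln \<Lambda> + \<psi> t) / \<psi> t"
        using elim by (simp add: add_divide_distrib)
      ultimately show ?case using elim lnf[of t] lnf[OF lt] by simp
    qed
    ultimately have "((\<lambda>t. ln (f (l * t)) / ln (f t)) \<longlongrightarrow> (0 + l powr \<alpha> * 1 powr \<beta>) / (0 + 1)) at_top"
      by (rule Lim_transform_eventually)
    then show ?thesis by simp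
  qed
qed

section \<open>Sharp constants for regularly varying \<open>ln f\<close>\<close>

context dominated_equation_P
begin

text \<open>For \<open>c \<le> 1\<close> and superpolynomial \<open>f\<close>, the function \<open>t\<^sup>2\<close> would belong to the class \<open>\<B>\<close>.\<close>
lemma c_gt_1:
  assumes "\<forall>\<^sub>F t in at_top. 2 * ln t \<le> ln (f t)"
  shows "c > 1"
proof (rule ccontr)
  assume "\<not> c > 1"
  then have c1: "c \<le> 1" by simp
  obtain K R where K: "\<forall>t\<ge>R. \<forall>k g. 0 \<le> k \<longrightarrow> k \<le> 0 * t \<longrightarrow> 0 \<le> g \<longrightarrow>
      (\<forall>\<xi>\<in>{0<..<1}. \<xi> * g * f (t + (1 - \<xi>) * g + k) powr c
              / (f (t + g + k) * f (t + k) powr c) \<le> 1) \<longrightarrow> g \<le> K * t"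
    using property_P_uniform_B[OF P, of 0 1] by (elim exE)
  obtain R2 where R2: "\<forall>t\<ge>R2. 2 * ln t \<le> ln (f t)"
    using assms unfolding eventually_at_top_linorder by blast
  define t where "t = max (max R R2) (max t0 (max K 1 + 1))"
  have t: "t \<ge> R" "t \<ge> R2" "t \<ge> t0" "t > K" "t > 1" by (auto simp: t_def)
  have ft: "f t > 0" using f_pos t by simp
  have "ln (t\<^sup>2) \<le> ln (f t)" using R2 t by (simp add: ln_realpow)
  then have t2: "t\<^sup>2 \<le> f t" using t ft by (subst (asm) ln_le_cancel_iff) auto
  have "\<xi> * t\<^sup>2 * f (t + (1 - \<xi>) * t\<^sup>2) powr c / (f (t + t\<^sup>2) * f t powr c) \<le> 1"
    if \<xi>: "\<xi> \<in> {0<..<1}" for \<xi>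
  proof -
    have fs: "f t \<le> f (t + t\<^sup>2)" using t by (intro f_le) auto
    have fm: "0 < f (t + (1 - \<xi>) * t\<^sup>2)" using t \<xi> by (intro f_pos) (auto intro: add_increasing2)
    have "(1 - \<xi>) * t\<^sup>2 \<le> 1 * t\<^sup>2" using \<xi> by (intro mult_right_mono) auto
    moreover have "0 \<le> (1 - \<xi>) * t\<^sup>2" using \<xi> by simp
    ultimately have "f (t + (1 - \<xi>) * t\<^sup>2) \<le> f (t + t\<^sup>2)" using t by (intro f_le) auto
    then have "\<xi> * t\<^sup>2 * f (t + (1 - \<xi>) * t\<^sup>2) powr c \<le> 1 * f t * f (t + t\<^sup>2) powr c"
      using \<xi> t2 fm ft c_pos by (intro mult_mono powr_mono2) auto
    also have "\<dots> \<le> f (t + t\<^sup>2) * f t powr c"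
    proof -
      \<comment> \<open>The exponent \<open>c - 1\<close> is nonpositive, so the power reverses
        \<open>f t \<le> f (t + t\<^sup>2)\<close>.\<close>
      have "f (t + t\<^sup>2) powr (c - 1) \<le> f t powr (c - 1)"
        using c1 ft fs by (intro powr_mono2') auto
      then have "f (t + t\<^sup>2) powr (c - 1) * (f t * f (t + t\<^sup>2)) \<le> f t powr (c - 1) * (f t * f (t + t\<^sup>2))"
        using ft fs by (intro mult_right_mono) auto
      then show ?thesis using ft fs by (simp add: powr_diff field_simps)
    qed
    finally show ?thesis using ft fs by (simp add: divide_le_eq)
  qed
  then have "t\<^sup>2 \<le> K * t" using K[rule_format, of t 0 "t\<^sup>2"] t by simp
  then have "t \<le> K" using t by (simp add: power2_eq_square)
  then show False using t by simp
qed

context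
  fixes \<alpha> :: real
  assumes \<alpha>: "\<alpha> > 0"
    and ratio: "\<And>l. l > 0 \<Longrightarrow> ((\<lambda>t. ln (f (l * t)) / ln (f t)) \<longlongrightarrow> l powr \<alpha>) at_top"
    and superpoly: "\<forall>\<^sub>F t in at_top. 2 * ln t \<le> ln (f t)"
begin

lemma ln_f_pos: "\<forall>\<^sub>F t in at_top. 0 < ln (f t)"
  using superpoly eventually_gt_at_top[of 1]
proof eventually_elim
  case (elim t)
  then have "0 < ln t" by simp
  then show ?case using elim by linarith
qed

text \<open>\<open>negative_phase\<close> at \<open>m = d * \<tau>\<close>,
  \<open>s = l * \<tau>\<close> gives in logarithms
  \<open>c * ln (f s) \<le> (c + 1) * ln (f m)\<close>. Dividing by \<open>ln (f \<tau>)\<close>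
  yields \<open>c * l powr \<alpha> \<le> (c + 1) * d powr \<alpha>\<close> in the limit, which
  fails for \<open>d\<close> close to 1.\<close>

lemma negative_phase_sharp:
  assumes l: "l > 1" "l powr \<alpha> > (c + 1) / c"
  shows "\<exists>R\<ge>t0. \<forall>\<tau>\<ge>R. \<forall>e. zero_free \<tau> e \<longrightarrow> l * \<tau> < e \<longrightarrow> - 1 < y (l * \<tau>)"
proof -
  \<comment> \<open>\<open>d powr \<alpha>\<close> is the midpoint of 1 and
    \<open>c * l powr \<alpha> / (c + 1)\<close>. For \<open>\<tau> \<ge> 2 / (d - 1)\<close> the
    factor \<open>(d - 1) * \<tau>\<close> absorbs the constant 2.\<close>
  define d where "d = ((1 + c * l powr \<alpha> / (c + 1)) / 2) powr (1 / \<alpha>)"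
  have w: "c * l powr \<alpha> / (c + 1) > 1" using l(2) c_pos by (simp add: field_simps)
  have da: "d powr \<alpha> = (1 + c * l powr \<alpha> / (c + 1)) / 2"
    using w \<alpha> unfolding d_def by (simp add: powr_powr)
  have d: "d > 1"
    unfolding d_def using w \<alpha> by (intro gr_one_powr) auto
  have dl: "(c + 1) * d powr \<alpha> < c * l powr \<alpha>"
  proof -
    have "d powr \<alpha> < c * l powr \<alpha> / (c + 1)" using w da by simp
    then show ?thesis using c_pos by (simp add: pos_less_divide_eq mult.commute)
  qed
  have "d < l"
  proof (rule ccontr)
    assume "\<not> d < l"
    then have "l powr \<alpha> \<le> d powr \<alpha>" using l \<alpha> by (intro powr_mono2) auto
    then have "c * l powr \<alpha> \<le> (c + 1) * d powr \<alpha>"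
      using c_pos by (intro mult_mono) auto
    then show False using dl by simp
  qed
  have "((\<lambda>t. c * (ln (f (l * t)) / ln (f t)) - (c + 1) * (ln (f (d * t)) / ln (f t))) \<longlongrightarrow>
      c * l powr \<alpha> - (c + 1) * d powr \<alpha>) at_top"
    by (intro tendsto_intros ratio) (use l d in auto)
  then have "\<forall>\<^sub>F t in at_top. 0 < c * (ln (f (l * t)) / ln (f t)) - (c + 1) * (ln (f (d * t)) / ln (f t))"
    using dl by (intro order_tendstoD(1)) auto
  then have "\<forall>\<^sub>F t in at_top. (c + 1) * ln (f (d * t)) < c * ln (f (l * t))"
    using ln_f_pos
  proof eventually_elim
    case (elim t)
    then have "0 * ln (f t) < (c * (ln (f (l * t)) / ln (f t)) - (c + 1) * (ln (f (d * t)) / ln (f t))) * ln (f t)"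
      by (intro mult_strict_right_mono) auto
    also have "\<dots> = c * ln (f (l * t)) - (c + 1) * ln (f (d * t))"
      using elim(2) by (simp add: left_diff_distrib)
    finally show ?case by simp
  qed
  then obtain R1 where R1: "\<forall>t\<ge>R1. (c + 1) * ln (f (d * t)) < c * ln (f (l * t))"
    unfolding eventually_at_top_linorder by blast
  have "- 1 < y (l * \<tau>)" if \<tau>: "\<tau> \<ge> max R1 (max t0 (2 / (d - 1)))" and zf: "zero_free \<tau> e" and e: "l * \<tau> < e" for \<tau> e
  proof (rule ccontr)
    assume "\<not> - 1 < y (l * \<tau>)"
    then have ys: "y (l * \<tau>) \<le> - 1" by simp
    have \<tau>0: "t0 \<le> \<tau>" "\<tau> > 0" using \<tau> t0_pos by auto
    have nz: "\<And>t. t \<in> {\<tau><..<e} \<Longrightarrow> z t \<noteq> 0" using zf zero_free_def by blast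
    have m: "\<tau> < d * \<tau>" "d * \<tau> \<le> l * \<tau>" using d \<open>d < l\<close> \<tau>0 by auto
    have ff: "f (d * \<tau>) > 0" "f (l * \<tau>) > 0" using m \<tau>0(1) by (intro f_pos; linarith)+
    have b: "(d * \<tau> - \<tau>) * f (l * \<tau>) powr c / f (d * \<tau>) powr (c + 1) \<le> 2"
      by (rule negative_phase[OF \<tau>0(1) nz m e ys])
    have "2 / (d - 1) \<le> \<tau>" using \<tau> by simp
    then have "2 \<le> d * \<tau> - \<tau>" using d by (simp add: pos_divide_le_eq algebra_simps)
    then have "2 * f (l * \<tau>) powr c \<le> (d * \<tau> - \<tau>) * f (l * \<tau>) powr c" by (intro mult_right_mono) auto
    also have "\<dots> \<le> 2 * f (d * \<tau>) powr (c + 1)" using b ff by (simp add: divide_le_eq)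
    finally have "f (l * \<tau>) powr c \<le> f (d * \<tau>) powr (c + 1)" by simp
    then have "ln (f (l * \<tau>) powr c) \<le> ln (f (d * \<tau>) powr (c + 1))"
      by (rule iffD2[OF ln_le_cancel_iff, rotated 2]) (use ff in auto)
    then have "c * ln (f (l * \<tau>)) \<le> (c + 1) * ln (f (d * \<tau>))" using ff by (simp only: ln_powr)
    moreover have "(c + 1) * ln (f (d * \<tau>)) < c * ln (f (l * \<tau>))" using R1 \<tau> by simp
    ultimately show False by simp
  qed
  then show ?thesis by (intro exI[of _ "max R1 (max t0 (2 / (d - 1)))"]) auto
qed

text \<open>\<open>positive_phase\<close> at \<open>m = d * l * p\<close>, \<open>s = l * p\<close>
  gives \<open>c * (d * l) powr \<alpha> \<le> l powr \<alpha> + c\<close> in the limit. Letting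
  \<open>d\<close> tend to 1 shows that \<open>c / (c - 1)\<close> is the critical value of
  \<open>l powr \<alpha>\<close>.\<close>

lemma positive_phase_sharp:
  assumes c1: "c > 1" and l: "l > 1" "l powr \<alpha> > c / (c - 1)"
  shows "\<exists>R\<ge>t0. \<forall>\<tau>\<ge>R. \<forall>e p. zero_free \<tau> e \<longrightarrow> \<tau> < p \<longrightarrow> p < e \<longrightarrow> 1 \<le> y p \<longrightarrow> e \<le> l * p"
proof -
  \<comment> \<open>The value of \<open>d powr \<alpha>\<close> at which the limiting inequality
    becomes an equality. It is below 1 by the choice of \<open>l\<close>, and
    \<open>d powr \<alpha>\<close> is put halfway between it and 1.\<close>
  define \<omega> where "\<omega> = (l powr \<alpha> + c) / (c * l powr \<alpha>)"
  define d where "d = ((1 + \<omega>) / 2) powr (1 / \<alpha>)"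
  have la: "l powr \<alpha> > 0" using l by simp
  have "c < (c - 1) * l powr \<alpha>" using l(2) c1 by (simp add: pos_divide_less_eq mult.commute)
  then have w: "\<omega> < 1" using la c_pos by (simp add: \<omega>_def field_simps)
  have w0: "0 < \<omega>" using la c_pos by (simp add: \<omega>_def add_pos_pos)
  have da: "d powr \<alpha> = (1 + \<omega>) / 2"
    using w w0 \<alpha> unfolding d_def by (simp add: powr_powr)
  have d: "0 < d" "d < 1"
  proof -
    show "0 < d" using w0 by (simp add: d_def)
    show "d < 1"
    proof (rule ccontr)
      assume "\<not> d < 1"
      then have "1 \<le> d powr \<alpha>" using \<alpha> by (simp add: ge_one_powr_ge_zero)
      then show False using da w by simp
    qed
  qed
  have key: "l powr \<alpha> + c < c * (d * l) powr \<alpha>"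
  proof -
    have "\<omega> < d powr \<alpha>" using da w by simp
    then have "\<omega> * (c * l powr \<alpha>) < d powr \<alpha> * (c * l powr \<alpha>)" using la c_pos by simp
    moreover have "\<omega> * (c * l powr \<alpha>) = l powr \<alpha> + c" using la c_pos by (simp add: \<omega>_def)
    ultimately show ?thesis using d l by (simp add: powr_mult mult_ac)
  qed
  have dl: "1 < d * l"
  proof (rule ccontr)
    assume "\<not> 1 < d * l"
    then have "(d * l) powr \<alpha> \<le> 1 powr \<alpha>" using d l \<alpha> by (intro powr_mono2) auto
    then have "c * (d * l) powr \<alpha> \<le> c * 1" using c_pos by (intro mult_left_mono) auto
    then show False using key la by simp
  qed
  have "((\<lambda>t. c * (ln (f ((d * l) * t)) / ln (f t)) - ln (f (l * t)) / ln (f t)) \<longlongrightarrow>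
      c * (d * l) powr \<alpha> - l powr \<alpha>) at_top"
    by (intro tendsto_intros ratio) (use l d in auto)
  then have "\<forall>\<^sub>F t in at_top. c < c * (ln (f ((d * l) * t)) / ln (f t)) - ln (f (l * t)) / ln (f t)"
    using key by (intro order_tendstoD(1)) auto
  then have "\<forall>\<^sub>F t in at_top. ln (f (l * t)) + c * ln (f t) < c * ln (f (d * l * t))"
    using ln_f_pos
  proof eventually_elim
    case (elim t)
    then have "c * ln (f t) < (c * (ln (f ((d * l) * t)) / ln (f t)) - ln (f (l * t)) / ln (f t)) * ln (f t)"
      by (intro mult_strict_right_mono) auto
    also have "\<dots> = c * ln (f (d * l * t)) - ln (f (l * t))"
      using elim(2) by (simp add: left_diff_distrib)
    finally show ?case by simp
  qed
  then obtain R1 where R1: "\<forall>t\<ge>R1. ln (f (l * t)) + c * ln (f t) < c * ln (f (d * l * t))"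
    unfolding eventually_at_top_linorder by blast
  define R where "R = max R1 (max t0 (1 / ((1 - d) * l)))"
  have "e \<le> l * p" if \<tau>: "\<tau> \<ge> R" and zf: "zero_free \<tau> e" and p: "\<tau> < p" "p < e" "1 \<le> y p" for \<tau> e p
  proof (rule ccontr)
    assume "\<not> e \<le> l * p"
    then have e: "l * p < e" by simp
    have \<tau>0: "t0 \<le> \<tau>" "\<tau> > 0" "R1 \<le> p" "1 / ((1 - d) * l) \<le> p" using \<tau> p t0_pos by (auto simp: R_def)
    have nz: "\<And>t. t \<in> {\<tau><..<e} \<Longrightarrow> z t \<noteq> 0" using zf zero_free_def by blast
    have p0: "p > 0" using p \<tau>0 by simp
    have m: "p \<le> d * l * p" "d * l * p \<le> l * p" using dl d l p0 by auto
    have ff: "f (d * l * p) > 0" "f (l * p) > 0" "f p > 0" using m \<tau>0(1) p(1) by (intro f_pos; linarith)+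
    have b: "(l * p - d * l * p) * f (d * l * p) powr c / (f (l * p) * f p powr c) \<le> 1"
      by (rule positive_phase[OF \<tau>0(1) nz p(1) m e p(3)])
    have "1 \<le> p * ((1 - d) * l)" using \<tau>0(4) d l by (simp add: pos_divide_le_eq)
    then have "1 \<le> l * p - d * l * p" by (simp add: algebra_simps)
    then have "1 * f (d * l * p) powr c \<le> (l * p - d * l * p) * f (d * l * p) powr c" by (intro mult_right_mono) auto
    also have "\<dots> \<le> f (l * p) * f p powr c" using b ff by (simp add: divide_le_eq)
    finally have "f (d * l * p) powr c \<le> f (l * p) * f p powr c" by simp
    then have "ln (f (d * l * p) powr c) \<le> ln (f (l * p) * f p powr c)"
      by (rule iffD2[OF ln_le_cancel_iff, rotated 2]) (use ff in auto)
    also have "\<dots> = ln (f (l * p)) + c * ln (f p)" using ff by (simp add: ln_mult ln_powr)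
    finally have "c * ln (f (d * l * p)) \<le> ln (f (l * p)) + c * ln (f p)" using ff by (simp only: ln_powr)
    moreover have "ln (f (l * p)) + c * ln (f p) < c * ln (f (d * l * p))" using R1 \<tau>0 by simp
    ultimately show False by simp
  qed
  then show ?thesis by (intro exI[of _ R]) (auto simp: R_def)
qed

text \<open>Each of the three phases is granted a slack factor \<open>\<eta>\<close> over its
  critical ratio, which is \<open>\<kappa>\<close>, 1 and \<open>\<kappa>'\<close> respectively; in
  \<open>\<kappa> * \<kappa>'\<close> the factor \<open>c\<close> cancels.\<close>

lemma zero_free_bound_sharp:
  assumes \<eta>: "\<eta> > 1"
  shows "\<exists>R\<ge>t0. \<forall>\<tau>\<ge>R. \<forall>e. zero_free \<tau> e \<longrightarrow> e \<le> \<eta> ^ 3 * ((c + 1) / (c - 1)) powr (1 / \<alpha>) * \<tau>"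
proof -
  have c1: "c > 1" by (rule c_gt_1[OF superpoly])
  define \<kappa> where "\<kappa> = ((c + 1) / c) powr (1 / \<alpha>)"
  define \<kappa>' where "\<kappa>' = (c / (c - 1)) powr (1 / \<alpha>)"
  have k: "\<kappa> > 1" "\<kappa>' > 1" unfolding \<kappa>_def \<kappa>'_def using c1 \<alpha> by (auto intro!: gr_one_powr)
  have ka: "\<kappa> powr \<alpha> = (c + 1) / c" "\<kappa>' powr \<alpha> = c / (c - 1)"
    unfolding \<kappa>_def \<kappa>'_def using c1 \<alpha> by (simp_all add: powr_powr)
  have kk: "\<kappa> * \<kappa>' = ((c + 1) / (c - 1)) powr (1 / \<alpha>)"
    unfolding \<kappa>_def \<kappa>'_def using c1 by (simp flip: powr_mult)
  have \<eta>a: "\<eta> powr \<alpha> > 1" using \<eta> \<alpha> by (simp add: gr_one_powr)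
  define l where "l = \<eta> * \<kappa>"
  define l' where "l' = \<eta> * \<kappa>'"
  have l: "l > 1" "l' > 1" using \<eta> k by (auto simp: l_def l'_def less_1_mult)
  have "1 * \<kappa> powr \<alpha> < \<eta> powr \<alpha> * \<kappa> powr \<alpha>" "1 * \<kappa>' powr \<alpha> < \<eta> powr \<alpha> * \<kappa>' powr \<alpha>"
    using \<eta>a k by (intro mult_strict_right_mono; simp)+
  then have la: "l powr \<alpha> > (c + 1) / c" "l' powr \<alpha> > c / (c - 1)"
    using \<eta> k by (simp_all add: l_def l'_def powr_mult ka)
  obtain R1 where R1: "R1 \<ge> t0" "\<forall>\<tau>\<ge>R1. \<forall>e. zero_free \<tau> e \<longrightarrow> l * \<tau> < e \<longrightarrow> - 1 < y (l * \<tau>)"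
    using negative_phase_sharp[OF l(1) la(1)] by blast
  obtain R2 where R2: "\<forall>\<tau>\<ge>R2. \<forall>e p. zero_free \<tau> e \<longrightarrow> \<tau> < p \<longrightarrow> \<eta> * p < e \<longrightarrow> - 1 < y p \<longrightarrow> 1 \<le> y (\<eta> * p)"
    using crossing_phase[OF \<eta>] by blast
  obtain R3 where R3: "\<forall>\<tau>\<ge>R3. \<forall>e p. zero_free \<tau> e \<longrightarrow> \<tau> < p \<longrightarrow> p < e \<longrightarrow> 1 \<le> y p \<longrightarrow> e \<le> l' * p"
    using positive_phase_sharp[OF c1 l(2) la(2)] by blast
  have "e \<le> l' * (\<eta> * (l * \<tau>))" if \<tau>: "\<tau> \<ge> max R1 (max R2 R3)" and zf: "zero_free \<tau> e" for \<tau> e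
  proof -
    have \<tau>0: "\<tau> > 0" using \<tau> R1 t0_pos by auto
    have o: "\<tau> < l * \<tau>" using l \<tau>0 by simp
    have o2: "l * \<tau> < \<eta> * (l * \<tau>)" using \<eta> o \<tau>0 by simp
    have o3: "\<eta> * (l * \<tau>) < l' * (\<eta> * (l * \<tau>))" using l(2) o o2 \<tau>0 by simp
    show ?thesis
    proof (cases "\<eta> * (l * \<tau>) < e")
      case True
      then have "l * \<tau> < e" using o2 by linarith
      then have "- 1 < y (l * \<tau>)" using R1(2) \<tau> zf by auto
      then have "1 \<le> y (\<eta> * (l * \<tau>))" using R2 \<tau> zf o True by auto
      moreover have "\<tau> < \<eta> * (l * \<tau>)" using o o2 by linarith
      ultimately show ?thesis using R3 \<tau> zf True by auto
    next
      case False
      then show ?thesis using o3 by linarith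
    qed
  qed
  moreover have "l' * (\<eta> * (l * \<tau>)) = \<eta> ^ 3 * (\<kappa> * \<kappa>') * \<tau>" for \<tau>
    by (simp add: l_def l'_def power3_eq_cube mult_ac)
  ultimately show ?thesis unfolding kk using R1(1)
    by (intro exI[of _ "max R1 (max R2 R3)"]) auto
qed

end

end

section \<open>From the integrability hypotheses to the locale\<close>

lemma locally_lipschitz_on_imp_lip:
  assumes "locally_lipschitz_on {a..} z"
  shows "lip a b z"
proof -
  \<comment> \<open>\<open>local_lipschitz\<close> concerns time-dependent maps; a singleton set of
    times reduces it to the present case, and compactness of \<open>{a..b}\<close> makes the
    constant global.\<close>
  have "local_lipschitz {0::real} {a..b} (\<lambda>_. z)"
  proof (rule local_lipschitzI)
    fix x assume "x \<in> {a..b}"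
    then have "x \<in> {a..}" by simp
    then obtain e L where e: "e > 0" "L-lipschitz_on (ball x e \<inter> {a..}) z"
      using assms unfolding locally_lipschitz_on_def by meson
    have "cball x (e / 2) \<inter> {a..b} \<subseteq> ball x e \<inter> {a..}" using e(1) by auto
    then have "L-lipschitz_on (cball x (e / 2) \<inter> {a..b}) z" using e(2) lipschitz_on_subset by blast
    then show "\<exists>u>0. \<exists>L. \<forall>t\<in>cball t u \<inter> {0}. L-lipschitz_on (cball x u \<inter> {a..b}) z" for t :: real
      using e(1) by (intro exI[of _ "e / 2"]) auto
  qed
  then obtain L where "\<And>t. t \<in> {0::real} \<Longrightarrow> L-lipschitz_on {a..b} z"
    by (rule local_lipschitz_compact_implies_lipschitz) auto
  then show ?thesis unfolding lip_def by blast
qed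

lemma Linf_loc_bounded:
  assumes "Linf_loc {a..} g"
  shows "\<exists>M. AE x in lebesgue. x \<in> {a..b} \<longrightarrow> \<bar>g x\<bar> \<le> M"
  using assms unfolding Linf_loc_def by (metis atLeastatMost_subset_iff compact_Icc Icc_subset_Ici_iff order_refl)

text \<open>The bound is the integral of \<open>\<bar>g\<bar>\<close> over the half-line, so it is
  independent of the interval.\<close>

lemma L1_at_top_integrals_bounded:
  assumes "L1_at_top g"
  shows "\<exists>R M. \<forall>p\<ge>R. \<forall>q\<ge>p. g integrable_on {p..q} \<and> integral {p..q} g \<le> M"
proof -
  obtain R where R: "set_integrable lebesgue {R..} g" using assms L1_at_top_def by blast
  have int: "g integrable_on S" "(\<lambda>x. \<bar>g x\<bar>) integrable_on S" if "S \<subseteq> {R..}" "S \<in> sets lebesgue" for S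
  proof -
    have "g absolutely_integrable_on S" using set_integrable_subset[OF R that(2,1)] .
    then show "g integrable_on S" "(\<lambda>x. \<bar>g x\<bar>) integrable_on S"
      unfolding absolutely_integrable_on_def by simp_all
  qed
  have "g integrable_on {p..q} \<and> integral {p..q} g \<le> integral {R..} (\<lambda>x. \<bar>g x\<bar>)"
    if "p \<ge> R" for p q
  proof
    have sub: "{p..q} \<subseteq> {R..}" using that by auto
    show i: "g integrable_on {p..q}" using int(1)[OF sub] by simp
    have "integral {p..q} g \<le> integral {p..q} (\<lambda>x. \<bar>g x\<bar>)"
      using i int(2)[OF sub] by (intro integral_le) auto
    also have "\<dots> \<le> integral {R..} (\<lambda>x. \<bar>g x\<bar>)"
      using int(2)[OF sub] int(2)[of "{R..}"] by (intro integral_subset_le[OF sub]) auto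
    finally show "integral {p..q} g \<le> integral {R..} (\<lambda>x. \<bar>g x\<bar>)" .
  qed
  then show ?thesis by blast
qed

theorem theorem4p1:
  fixes t0 T D \<mu> c z0 :: real
    and v f f' A z T1 T2 :: "real \<Rightarrow> real"
  assumes "t0 > 0"
    and "AE t\<in>{t0..} in lebesgue. 0 \<le> v t"
    and "Linf_loc {t0..} v"
    and "recip_Linf_loc {t0..} v"
    and "L1_at_top (\<lambda>t. 1 / v t)"
    and "\<And>t. t \<ge> t0 \<Longrightarrow> (f has_real_derivative f' t) (at t within {t0..})"
    and "continuous_on {t0..} f'"
    and "f t0 > 0"
    and "mono_on {t0..} f"
    and "AE t\<in>{t0..} in lebesgue. v t \<le> f t"
    and "D > 0" and "\<mu> < 1"
    and "\<And>t. t \<ge> t0 \<Longrightarrow> f' t / f t \<ge> 1 / (D * t powr \<mu>)"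
    and "Linf_loc {t0..} A"
    and "AE t\<in>{t0..} in lebesgue. 0 \<le> A t"
    and "Limsup at_top (\<lambda>t. ereal (LINT s:{t0..t}|lebesgue. sqrt (A s) - sqrt (crit_fun v s))) = \<infinity>"
    and "c > 0"
    and "AE t\<in>{t0..} in lebesgue. sqrt (A t) \<ge> c / 2 * (f' t / f t)"
    and "property_P t0 f c"
    and "\<exists>t\<ge>t0. z t \<noteq> 0"
    and "locally_lipschitz_on {t0..} z"
    and "solves_ode t0 v A z"
    and "z t0 = z0" and "z0 \<noteq> 0"
    and "T > t0"
    and "\<And>\<tau>. \<tau> \<ge> T \<Longrightarrow> T1 \<tau> = (LEAST t. t \<ge> \<tau> \<and> z t = 0)"
    and "\<And>\<tau>. \<tau> \<ge> T \<Longrightarrow> T2 \<tau> = (LEAST t. t > T1 \<tau> \<and> z t = 0)"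
  shows "(\<lambda>\<tau>. T2 \<tau> - \<tau>) \<in> O[at_top](\<lambda>\<tau>. \<tau>)
    \<and> (\<forall>\<Lambda> a \<alpha> \<beta>. \<Lambda> > 0 \<and> a > 0 \<and> \<alpha> > 0 \<and> \<beta> \<ge> 0
         \<and> (\<forall>t\<ge>t0. f t = \<Lambda> * exp (a * t powr \<alpha> * real_pow (ln t) \<beta>))
         \<longrightarrow> Limsup at_top (\<lambda>\<tau>. ereal (T2 \<tau> / \<tau>)) \<le> ereal (((c + 1) / (c - 1)) powr (2 / \<alpha>)))"
proof -
  obtain w where w: "locally_abs_continuous_on {t0..} w"
    "AE t\<in>{t0<..} in lebesgue. \<exists>z'. (z has_real_derivative z') (at t) \<and> v t * z' = w t"
    "AE t\<in>{t0<..} in lebesgue. (w has_real_derivative - (A t * v t * z t)) (at t)"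
    using assms(22) unfolding solves_ode_def by blast
  have vnz: "AE t\<in>{t0..} in lebesgue. v t \<noteq> 0" and vinv: "Linf_loc {t0..} (\<lambda>x. 1 / v x)"
    using assms(4) unfolding recip_Linf_loc_def by auto
  interpret dominated_equation_P t0 c v f f' A z w D \<mu>
  proof
    show "AE t in lebesgue. t \<in> {t0<..} \<longrightarrow> 0 < v t \<and> v t \<le> f t \<and> 0 \<le> A t \<and>
       c / 2 * (f' t / f t) \<le> sqrt (A t) \<and> (z has_real_derivative w t / v t) (at t) \<and>
       (w has_real_derivative - (A t * v t * z t)) (at t)"
      using assms(2,10,15,18) vnz w(2,3)
    proof eventually_elim
      case (elim t)
      show ?case
      proof
        assume t: "t \<in> {t0<..}"
        then have v: "0 < v t" using elim(1,5) by auto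
        obtain z' where z': "(z has_real_derivative z') (at t)" "v t * z' = w t"
          using elim(6) t by blast
        have "z' = w t / v t" using z'(2) v by (simp add: field_simps)
        then have "(z has_real_derivative w t / v t) (at t)" using z'(1) by simp
        then show "0 < v t \<and> v t \<le> f t \<and> 0 \<le> A t \<and> c / 2 * (f' t / f t) \<le> sqrt (A t) \<and>
           (z has_real_derivative w t / v t) (at t) \<and>
           (w has_real_derivative - (A t * v t * z t)) (at t)"
          using v elim t by auto
      qed
    qed
    show "\<exists>B. AE t in lebesgue. t \<in> {t0<..b} \<longrightarrow> 1 / v t \<le> B \<and> A t * v t \<le> B" for b
    proof -
      obtain M1 where M1: "AE t in lebesgue. t \<in> {t0..b} \<longrightarrow> \<bar>1 / v t\<bar> \<le> M1"
        using Linf_loc_bounded[OF vinv] by blast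
      obtain M2 where M2: "AE t in lebesgue. t \<in> {t0..b} \<longrightarrow> \<bar>A t\<bar> \<le> M2"
        using Linf_loc_bounded[OF assms(14)] by blast
      obtain M3 where M3: "AE t in lebesgue. t \<in> {t0..b} \<longrightarrow> \<bar>v t\<bar> \<le> M3"
        using Linf_loc_bounded[OF assms(3)] by blast
      have "AE t in lebesgue. t \<in> {t0<..b} \<longrightarrow> 1 / v t \<le> max M1 (M2 * M3) \<and> A t * v t \<le> max M1 (M2 * M3)"
        using M1 M2 M3
      proof eventually_elim
        case (elim t)
        show ?case
        proof
          assume "t \<in> {t0<..b}"
          then have e: "\<bar>1 / v t\<bar> \<le> M1" "\<bar>A t\<bar> \<le> M2" "\<bar>v t\<bar> \<le> M3" using elim by auto
          have "A t * v t \<le> \<bar>A t\<bar> * \<bar>v t\<bar>" by (metis abs_ge_self abs_mult)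
          also have "\<dots> \<le> M2 * M3" using e by (intro mult_mono) auto
          finally show "1 / v t \<le> max M1 (M2 * M3) \<and> A t * v t \<le> max M1 (M2 * M3)"
            using order_trans[OF abs_ge_self e(1)] by (simp add: le_max_iff_disj)
        qed
      qed
      then show ?thesis by blast
    qed
    show "lip t0 b z" for b by (rule locally_lipschitz_on_imp_lip[OF assms(21)])
    show "z t0 \<noteq> 0" using assms(23,24) by simp
    show "\<exists>R M. \<forall>p\<ge>R. \<forall>q\<ge>p. (\<lambda>t. 1 / v t) integrable_on {p..q} \<and> integral {p..q} (\<lambda>t. 1 / v t) \<le> M"
      by (rule L1_at_top_integrals_bounded[OF assms(5)])
  qed (use assms w(1) in auto)
  \<comment> \<open>Both claims are instances: \<open>L = K\<close> for the O-bound, and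
    \<open>L = \<eta> ^ 3 * B\<close> with \<open>\<eta>\<close> tending to 1 for the
    limsup.\<close>
  have main: "\<exists>S>0. \<forall>\<tau>\<ge>S. \<tau> < T2 \<tau> \<and> T2 \<tau> \<le> L * (L * \<tau>)"
    if "R \<ge> t0" "\<forall>\<tau>\<ge>R. \<forall>e. zero_free \<tau> e \<longrightarrow> e \<le> L * \<tau>" for L R
  proof (intro exI[of _ "max R T"] conjI allI impI)
    show "0 < max R T" using that assms(1) by auto
    fix \<tau> assume "\<tau> \<ge> max R T"
    then have \<tau>: "\<tau> \<ge> R" "\<tau> \<ge> T" by auto
    note cz = consecutive_zeros_bound[OF that \<tau>(1) assms(26)[OF \<tau>(2)] assms(27)[OF \<tau>(2)]]
    show "\<tau> < T2 \<tau>" using cz(1,2) by simp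
    show "T2 \<tau> \<le> L * (L * \<tau>)" by (rule cz(3))
  qed
  have "(\<lambda>\<tau>. T2 \<tau> - \<tau>) \<in> O[at_top](\<lambda>\<tau>. \<tau>)"
  proof -
    obtain K R where KR: "R \<ge> t0" "\<forall>\<tau>\<ge>R. \<forall>e. zero_free \<tau> e \<longrightarrow> e \<le> K * \<tau>"
      using zero_free_bound by blast
    obtain S where S: "S > 0" "\<forall>\<tau>\<ge>S. \<tau> < T2 \<tau> \<and> T2 \<tau> \<le> K * (K * \<tau>)" using main[OF KR] by blast
    show ?thesis
    proof (rule bigoI[of _ "K * K"])
      show "\<forall>\<^sub>F \<tau> in at_top. norm (T2 \<tau> - \<tau>) \<le> K * K * norm \<tau>"
        using eventually_ge_at_top[of S]
      proof eventually_elim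
        case (elim \<tau>)
        then have "\<tau> < T2 \<tau>" "T2 \<tau> \<le> K * K * \<tau>" "0 < \<tau>" using S by (auto simp: mult.assoc)
        then show ?case by simp
      qed
    qed
  qed
  moreover have "Limsup at_top (\<lambda>\<tau>. ereal (T2 \<tau> / \<tau>)) \<le> ereal (((c + 1) / (c - 1)) powr (2 / \<alpha>))"
    if par: "\<Lambda> > 0" "a > 0" "\<alpha> > 0" "\<beta> \<ge> 0"
      and f: "\<forall>t\<ge>t0. f t = \<Lambda> * exp (a * t powr \<alpha> * real_pow (ln t) \<beta>)" for \<Lambda> a \<alpha> \<beta>
  proof -
    note as = exponential_f_asymptotics[OF par, of t0 f, OF f[rule_format]]
    \<comment> \<open>The asymptotic cost of one zero-free interval; two of them give the exponent
      \<open>2 / \<alpha>\<close>.\<close>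
    define B where "B = ((c + 1) / (c - 1)) powr (1 / \<alpha>)"
    have B: "B * B = ((c + 1) / (c - 1)) powr (2 / \<alpha>)"
      unfolding B_def by (simp flip: powr_add)
    have bound: "Limsup at_top (\<lambda>\<tau>. ereal (T2 \<tau> / \<tau>)) \<le> ereal (\<eta> ^ 3 * B * (\<eta> ^ 3 * B))" if \<eta>: "\<eta> > 1" for \<eta>
    proof -
      obtain R where R: "R \<ge> t0" "\<forall>\<tau>\<ge>R. \<forall>e. zero_free \<tau> e \<longrightarrow> e \<le> \<eta> ^ 3 * B * \<tau>"
        using zero_free_bound_sharp[OF par(3) as \<eta>] unfolding B_def by blast
      obtain S where S: "S > 0" "\<forall>\<tau>\<ge>S. \<tau> < T2 \<tau> \<and> T2 \<tau> \<le> \<eta> ^ 3 * B * (\<eta> ^ 3 * B * \<tau>)"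
        using main[OF R] by blast
      show ?thesis
      proof (rule Limsup_bounded)
        show "\<forall>\<^sub>F \<tau> in at_top. ereal (T2 \<tau> / \<tau>) \<le> ereal (\<eta> ^ 3 * B * (\<eta> ^ 3 * B))"
          using eventually_ge_at_top[of S]
        proof eventually_elim
          case (elim \<tau>)
          then have "T2 \<tau> \<le> \<eta> ^ 3 * B * (\<eta> ^ 3 * B) * \<tau>" "0 < \<tau>" using S by (auto simp: mult.assoc)
          then show ?case by (simp add: divide_le_eq)
        qed
      qed
    qed
    \<comment> \<open>The left-hand side does not depend on the slack, so the slack can be sent to 1
      along a sequence.\<close>
    define \<eta> where "\<eta> n = 1 + 1 / real (Suc n)" for n
    have "\<eta> \<longlonglongrightarrow> 1 + 0" unfolding \<eta>_def
      by (intro tendsto_add tendsto_const LIMSEQ_Suc[OF lim_1_over_n])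
    then have "(\<lambda>n. \<eta> n ^ 3 * B * (\<eta> n ^ 3 * B)) \<longlonglongrightarrow> (1 + 0) ^ 3 * B * ((1 + 0) ^ 3 * B)"
      by (intro tendsto_intros)
    then have "(\<lambda>n. ereal (\<eta> n ^ 3 * B * (\<eta> n ^ 3 * B))) \<longlonglongrightarrow> ereal (B * B)"
      by simp
    moreover have "\<exists>N. \<forall>n\<ge>N. Limsup at_top (\<lambda>\<tau>. ereal (T2 \<tau> / \<tau>)) \<le> ereal (\<eta> n ^ 3 * B * (\<eta> n ^ 3 * B))"
      using bound by (simp add: \<eta>_def)
    ultimately have "Limsup at_top (\<lambda>\<tau>. ereal (T2 \<tau> / \<tau>)) \<le> ereal (B * B)"
      by (rule LIMSEQ_le_const)
    then show ?thesis unfolding B .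
  qed
  ultimately show ?thesis by blast
qed

end
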